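(* Let $0<\alpha\le 1$ and $0<d<\pi/2$, and write $\mathscr{D}=\psi^{\mathrm{DE}}(\mathscr{D}_d)$. Let $gQ$ and $\mu Q$ belong to $\mathbf{L}_{\alpha}(\mathscr{D})$. Moreover, let $k(z,\cdot)Q(\cdot)\in\mathbf{L}_{\alpha}(\mathscr{D})$ for all $z\in\mathscr{D}$ and $k(\cdot,w)Q(w)\in\mathbf{H}^{\infty}(\mathscr{D})$ for all $w\in\mathscr{D}$. Let $u$ be the solution of the initial value problem $$u'(t)=g(t)+\mu(t)u(t)+\int_a^t k(t,r)u(r)\,dr\quad (a\le t\le b),\qquad u(a)=u_a .$$ Then $gQ$, $\mu uQ$ and $(\mathcal{V}u)Q$ belong to $\mathbf{L}_{\alpha}(\mathscr{D})$. Furthermore, $k(s,\cdot)u(\cdot)Q(\cdot)\in\mathbf{L}_{\alpha}(\mathscr{D})$ for all $s\in[a,b]$.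
   Context: Let $a<b$ be real numbers and $u_a$ a given initial value. Set $Q(z)=(z-a)(b-z)$ and $\mathcal{V}[u](s)=\int_a^s k(s,r)u(r)\,dr$. The initial value problem is treated in its integrated form $u(t)=u_a+\int_a^t\{g(s)+\mu(s)u(s)+\mathcal{V}[u](s)\}\,ds$, $a\le t\le b$. Endpoint singularities of $g$ are allowed. Functions are regarded as functions of complex variables. For $d>0$, $\mathscr{D}_d=\{\zeta\in\mathbb{C}:|\operatorname{Im}\zeta|<d\}$. The DE transformation is $\psi^{\mathrm{DE}}(x)=\frac{b-a}{2}\tanh\left(\frac{\pi}{2}\sinh x\right)+\frac{b+a}{2}$, which maps $\mathbb{R}$ onto $(a,b)$, and $\psi^{\mathrm{DE}}(\mathscr{D}_d)=\{z=\psi^{\mathrm{DE}}(\zeta):\zeta\in\mathscr{D}_d\}$ is regarded as an infinitely sheeted Riemann surface with global parameter $\zeta\in\mathscr{D}_d$ (a function $f$ on it is a function of $\zeta$, and points of $(a,b)$ correspond to real $\zeta$). For $\alpha>0$ and a bounded simply connected domain (or Riemann surface) $\mathscr{D}\supset(a,b)$, $\mathbf{L}_{\alpha}(\mathscr{D})$ is the family of functions $f$ analytic on $\mathscr{D}$ for which there is a constant $K$ with $|f(z)|\le K|Q(z)|^{\alpha}$ for all $z\in\mathscr{D}$. $\mathbf{H}^{\infty}(\mathscr{D})$ is the family of functions $f$ analytic on $\mathscr{D}$ with $\|f\|_{\mathbf{H}^{\infty}(\mathscr{D})}=\sup_{z\in\mathscr{D}}|f(z)|<\infty$.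
   Formalization: The constant K in k(z,·)Q(·) ∈ L_α is assumed independent of z (with z-dependent constants (Vu)Q can fail to lie in L_α); for s=a and s=b, k(s,·) means the pointwise limit of k(t,·) along the interval, whenever it exists. *)

theory Defs
  imports "HOL-Complex_Analysis.Complex_Analysis"
begin

text \<open>
  The Riemann surface \<open>\<psi>(\<D>\<^sub>d)\<close> has the global parameter \<open>\<zeta> \<in> \<D>\<^sub>d\<close>, and \<open>\<psi>' \<noteq> 0\<close> on
  \<open>\<D>\<^sub>d\<close> for \<open>d < \<pi>/2\<close>. A function on the surface is therefore represented
  as a function of \<open>\<zeta>\<close>; it is analytic on the surface iff it is holomorphic on the strip.
\<close>

definition strip :: "real \<Rightarrow> complex set" where
  "strip d = {\<zeta>. \<bar>Im \<zeta>\<bar> < d}"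

definition psiDE :: "real \<Rightarrow> real \<Rightarrow> 'a::{real_normed_field,banach} \<Rightarrow> 'a" where
  "psiDE a b x = of_real ((b - a) / 2) * tanh (of_real (pi / 2) * sinh x) + of_real ((b + a) / 2)"

text \<open>The real parameter of a point \<open>t\<close> of the open interval \<open>(a,b)\<close>; no meaning elsewhere.\<close>

definition param :: "real \<Rightarrow> real \<Rightarrow> real \<Rightarrow> complex" where
  "param a b t = of_real (inv (psiDE a b) t)"

text \<open>\<open>Q(z) = (z - a)(b - z)\<close> at the surface point \<open>z\<close> with parameter \<open>\<zeta>\<close>.\<close>

definition Qs :: "real \<Rightarrow> real \<Rightarrow> complex \<Rightarrow> complex" where
  "Qs a b \<zeta> = (psiDE a b \<zeta> - of_real a) * (of_real b - psiDE a b \<zeta>)"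

definition L_space :: "real \<Rightarrow> real \<Rightarrow> real \<Rightarrow> real \<Rightarrow> (complex \<Rightarrow> complex) set" where
  "L_space a b d \<alpha> = {f. f holomorphic_on strip d \<and>
     (\<exists>K. \<forall>\<zeta>\<in>strip d. cmod (f \<zeta>) \<le> K * cmod (Qs a b \<zeta>) powr \<alpha>)}"

definition H_inf :: "real \<Rightarrow> (complex \<Rightarrow> complex) set" where
  "H_inf d = {f. f holomorphic_on strip d \<and> bounded (f ` strip d)}"

text \<open>
  The integrated initial value problem on the real interval. In the integrands \<open>param\<close> is
  evaluated outside \<open>(a,b)\<close> only at \<open>a\<close> and \<open>b\<close>, which form a null set. Taking \<open>t = a\<close>
  gives \<open>u a = u\<^sub>a\<close>; continuity of \<open>u\<close> on \<open>[a,b]\<close> is a consequence.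
\<close>

definition solves_ivp ::
  "real \<Rightarrow> real \<Rightarrow> complex \<Rightarrow> (complex \<Rightarrow> complex) \<Rightarrow> (complex \<Rightarrow> complex) \<Rightarrow>
   (complex \<Rightarrow> complex \<Rightarrow> complex) \<Rightarrow> (real \<Rightarrow> complex) \<Rightarrow> bool" where
  "solves_ivp a b ua g \<mu> k u \<longleftrightarrow>
     (\<forall>t\<in>{a..b}.
        ((\<lambda>s. g (param a b s) + \<mu> (param a b s) * u s
              + integral {a..s} (\<lambda>r. k (param a b s) (param a b r) * u r))
         has_integral (u t - ua)) {a..t})"

text \<open>
  \<open>v\<close> is the value of \<open>\<V>[u](z) = \<integral>\<^sub>a\<^sup>z k(z,w) u(w) dw\<close> at the surface point \<open>z\<close> with
  parameter \<open>\<zeta>\<close>. With \<open>w = \<psi>(\<omega>)\<close>, the end point \<open>a\<close> corresponds to \<open>\<omega> \<rightarrow> -\<infinity>\<close>,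
  so this is an improper contour integral in the strip; the integrand is holomorphic and the
  strip convex, so the segments may be replaced by any other paths with the same end points.
\<close>

definition has_volterra ::
  "real \<Rightarrow> real \<Rightarrow> (complex \<Rightarrow> complex \<Rightarrow> complex) \<Rightarrow> (complex \<Rightarrow> complex) \<Rightarrow>
   complex \<Rightarrow> complex \<Rightarrow> bool" where
  "has_volterra a b k u \<zeta> v \<longleftrightarrow>
     ((\<lambda>x. contour_integral (linepath (complex_of_real x) \<zeta>)
             (\<lambda>\<omega>. k \<zeta> \<omega> * u \<omega> * deriv (psiDE a b) \<omega>)) \<longlongrightarrow> v) at_bot"

end

theory Submission
  imports Defs
begin

text \<open>
  Write \<open>z = \<psi>(\<zeta>)\<close>. Since \<open>\<psi>'(\<zeta>) = \<pi>/(b - a) \<cdot> cosh \<zeta> \<cdot> Q\<close>, a function \<open>f\<close> with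
  \<open>|f Q| \<le> K |Q|\<^sup>\<alpha>\<close> satisfies \<open>|f \<psi>'| \<le> K' |cosh \<zeta>| |Q|\<^sup>\<alpha>\<close>. On the strip, \<open>Q\<close> decays doubly
  exponentially in \<open>|Re \<zeta>|\<close> (\<open>Qs_powr_bound\<close>), so this is at most \<open>C / cosh (Re \<zeta>)\<close>
  (\<open>psiDE_deriv_decay\<close>). The same holds for \<open>\<psi>'\<close> itself, because \<open>Q\<close> is bounded and \<open>\<alpha> \<le> 1\<close>. In the
  parameter \<open>\<zeta>\<close> the initial value problem therefore becomes
  \<open>U(\<zeta>) = u\<^sub>a + \<integral> (g + \<mu> U + V) \<psi>' d\<omega>\<close>, \<open>V(\<zeta>) = \<integral> k(\<zeta>,\<omega>) U(\<omega>) \<psi>'(\<omega>) d\<omega>\<close>, with both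
  integrals taken from \<open>-\<infinity>\<close> to \<open>\<zeta>\<close>,
  a Volterra equation on the whole strip in which every coefficient, multiplied by \<open>\<psi>'\<close>, is dominated
  by \<open>C / cosh\<close> of the real part. That majorant is integrable over every horizontal line, with the
  elementary primitive \<open>gudermann\<close>.

  The proof solves this equation and then identifies the solution with \<open>u\<close>.

  Existence (\<open>volterra_equation_strip\<close>): among bounded holomorphic functions the right hand side
  is a contraction with factor \<open>3/4\<close> for the norm weighted by \<open>exp (2 C gudermann (Re \<zeta>))\<close>.
  The integral from \<open>-\<infinity>\<close> is not tied to a path: it means the holomorphic primitive on the convex
  strip that tends to \<open>0\<close> at the left end (\<open>left_primitive\<close>), and an estimate of the integrand
  by the derivative of a real function \<open>\<phi>\<close> of \<open>Re \<zeta>\<close> turns into an estimate of the primitive by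
  \<open>\<phi>\<close>. The delicate point is that \<open>V\<close> is holomorphic although \<open>\<zeta>\<close> occurs both in
  the kernel and as the end point. The integral is separately holomorphic in these two places
  and bounded, and then its diagonal is holomorphic (\<open>holomorphic_on_diagonal\<close>, \<open>volterra_diagonal_holomorphic\<close>).

  Identification (\<open>solves_ivp_unique\<close>): on \<open>(a,b)\<close> the restriction of \<open>U\<close> solves the same real
  integral equation as \<open>u\<close>, by the fundamental theorem of calculus in the variable \<open>t = \<psi>(x)\<close>.
  Any solution \<open>u\<close> is continuous, hence bounded, and the estimate behind the contraction gives
  \<open>|u - U| \<le> (3/4)\<^sup>n M exp (2 C gudermann)\<close> for all \<open>n\<close>.

  Once \<open>U\<close> and \<open>V\<close> are known to be bounded and holomorphic, all memberships in
  \<open>L\<^sub>\<alpha>\<close> follow, since this space is stable under multiplication by such functions and under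
  dominated pointwise limits; the latter gives the end points \<open>s = a\<close> and \<open>s = b\<close>.
\<close>

section \<open>Limits, parameter integrals and fixed points of holomorphic functions\<close>

text \<open>
  By Montel's theorem a subsequence converges to a holomorphic function, which can only be the
  pointwise limit.
\<close>

lemma holomorphic_on_pointwise_limit:
  fixes f :: "nat \<Rightarrow> complex \<Rightarrow> complex"
  assumes S: "open S" and hol: "\<And>n. f n holomorphic_on S"
    and bnd: "\<And>n z. z \<in> S \<Longrightarrow> cmod (f n z) \<le> B"
    and lim: "\<And>z. z \<in> S \<Longrightarrow> (\<lambda>n. f n z) \<longlonglongrightarrow> g z"
  shows "g holomorphic_on S"
proof -
  obtain h r where h: "h holomorphic_on S" "strict_mono (r :: nat \<Rightarrow> nat)"
    and lim_h: "\<And>z. z \<in> S \<Longrightarrow> (\<lambda>n. f (r n) z) \<longlonglongrightarrow> h z"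
  proof (rule Montel[OF S, of "range f" f])
    show "\<exists>B. \<forall>h\<in>range f. \<forall>z\<in>K. norm (h z) \<le> B" if "K \<subseteq> S" for K
      using that bnd by (intro exI[of _ B]) auto
  qed (use hol in auto)
  have "h z = g z" if "z \<in> S" for z
    using LIMSEQ_unique[OF lim_h[OF that]] LIMSEQ_subseq_LIMSEQ[OF lim[OF that] h(2)]
    by (simp add: o_def)
  with h(1) show ?thesis
    using holomorphic_transform by blast
qed

lemma holomorphic_bounded_lipschitz:
  assumes "f holomorphic_on cball z (2 * r)" "0 < r"
    and bnd: "\<And>w. w \<in> cball z (2 * r) \<Longrightarrow> cmod (f w) \<le> B" and w: "w \<in> ball z r"
  shows "cmod (f w - f z) \<le> B / r * cmod (w - z)"
proof (rule field_differentiable_bound[OF convex_ball[of z r]])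
  have sub: "cball v r \<subseteq> cball z (2 * r)" if "v \<in> ball z r" for v
    using that by (simp add: cball_subset_cball_iff dist_commute)
  show "(f has_field_derivative deriv f v) (at v within ball z r)" if "v \<in> ball z r" for v
  proof -
    have "f holomorphic_on ball z r"
      using assms(1,2) holomorphic_on_subset by fastforce
    then show ?thesis
      using that holomorphic_derivI by blast
  qed
  show "cmod (deriv f v) \<le> B / r" if v: "v \<in> ball z r" for v
  proof -
    have h: "f holomorphic_on cball v r"
      using assms(1) holomorphic_on_subset sub[OF v] by blast
    have "cmod ((deriv ^^ 1) f v) \<le> fact 1 * B / r ^ 1"
    proof (rule Cauchy_inequality)
      show "f holomorphic_on ball v r" using h holomorphic_on_subset ball_subset_cball by blast
      show "continuous_on (cball v r) f" using h holomorphic_on_imp_continuous_on by blast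
      show "cmod (f x) \<le> B" if "cmod (v - x) = r" for x
        using that sub[OF v] by (intro bnd) (auto simp: dist_norm)
    qed (use assms in auto)
    then show ?thesis by simp
  qed
qed (use assms in auto)

text \<open>
  The difference quotients in \<open>z\<close> are uniformly bounded by the Cauchy estimate, so dominated convergence allows
  differentiation under the integral sign.
\<close>

lemma holomorphic_on_integral_parameter:
  fixes F :: "complex \<Rightarrow> real \<Rightarrow> complex"
  assumes S: "open S" and hol: "\<And>t. t \<in> {a..b} \<Longrightarrow> (\<lambda>z. F z t) holomorphic_on S"
    and cont: "\<And>z. z \<in> S \<Longrightarrow> continuous_on {a..b} (F z)"
    and bnd: "\<And>z t. z \<in> S \<Longrightarrow> t \<in> {a..b} \<Longrightarrow> cmod (F z t) \<le> B"
  shows "(\<lambda>z. integral {a..b} (F z)) holomorphic_on S"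
proof -
  have "(\<lambda>z. integral {a..b} (F z)) field_differentiable at z" if z: "z \<in> S" for z
  proof -
    obtain r' where "0 < r'" "cball z r' \<subseteq> S"
      using S z open_contains_cball by blast
    then obtain r where r: "0 < r" "cball z (2 * r) \<subseteq> S"
      by (metis mult.commute nonzero_divide_eq_eq zero_less_divide_iff zero_less_numeral zero_neq_numeral)
    let ?D = "\<lambda>t. deriv (\<lambda>w. F w t) z"
    let ?q = "\<lambda>w t. (F w t - F z t) / (w - z)"
    have lip: "cmod (?q w t) \<le> B / r" if "w \<in> ball z r - {z}" "t \<in> {a..b}" for w t
    proof -
      have "cmod (F w t - F z t) \<le> B / r * cmod (w - z)"
        using that r bnd
        by (intro holomorphic_bounded_lipschitz holomorphic_on_subset[OF hol[OF that(2)]]) auto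
      then show ?thesis
        using that by (simp add: norm_divide divide_le_eq)
    qed
    have "((\<lambda>w. (integral {a..b} (F w) - integral {a..b} (F z)) / (w - z))
            \<longlongrightarrow> integral {a..b} ?D) (at z within ball z r)"
      unfolding tendsto_at_iff_sequentially
    proof (intro allI impI)
      fix X assume X: "\<forall>i. X i \<in> ball z r - {z}" "X \<longlonglongrightarrow> z"
      have XS: "X i \<in> S" for i
      proof -
        have "X i \<in> cball z (2 * r)" using X(1) r(1) by (auto dest!: spec[of _ i])
        then show ?thesis using r(2) by blast
      qed
      have int: "(integral {a..b} (F (X n)) - integral {a..b} (F z)) / (X n - z)
                  = integral {a..b} (?q (X n))" for n
        using integrable_continuous_real[OF cont[OF XS]] integrable_continuous_real[OF cont[OF z]]
        by (simp add: integral_diff)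
      have "(\<lambda>n. integral {a..b} (?q (X n))) \<longlonglongrightarrow> integral {a..b} ?D"
      proof (rule dominated_convergence(2)[where h = "\<lambda>_. B / r"])
        show "?q (X n) integrable_on {a..b}" for n
          using X by (intro integrable_continuous_real continuous_intros cont XS z) auto
        show "(\<lambda>n. ?q (X n) t) \<longlonglongrightarrow> ?D t" if "t \<in> {a..b}" for t
        proof -
          have "((\<lambda>w. F w t) has_field_derivative ?D t) (at z)"
            using S hol holomorphic_derivI that z by blast
          then have "((\<lambda>w. ?q w t) \<longlongrightarrow> ?D t) (at z)"
            by (simp add: has_field_derivative_iff)
          then show ?thesis
            using X unfolding tendsto_at_iff_sequentially by (auto simp: o_def)
        qed
      qed (use X lip in auto)
      then show "((\<lambda>w. (integral {a..b} (F w) - integral {a..b} (F z)) / (w - z)) \<circ> X)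
                  \<longlonglongrightarrow> integral {a..b} ?D"
        by (simp add: o_def int)
    qed
    then have "((\<lambda>z. integral {a..b} (F z)) has_field_derivative integral {a..b} ?D) (at z)"
      using r(1) by (simp add: has_field_derivative_iff at_within_open[of z "ball z r"])
    then show ?thesis
      using field_differentiable_def by blast
  qed
  then show ?thesis
    using holomorphic_on_def field_differentiable_at_within by blast
qed

text \<open>
  A local form of Osgood's lemma. Cauchy's formula in the second variable writes \<open>f z z\<close> as the
  integral of \<open>f z \<eta> / (\<eta> - z)\<close> over a fixed circle, and there \<open>z\<close> occurs only as a holomorphic parameter.
\<close>

lemma holomorphic_on_diagonal:
  fixes f :: "complex \<Rightarrow> complex \<Rightarrow> complex"
  assumes S: "open S" and hol1: "\<And>w. w \<in> S \<Longrightarrow> (\<lambda>z. f z w) holomorphic_on S"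
    and hol2: "\<And>z. z \<in> S \<Longrightarrow> f z holomorphic_on S"
    and bnd: "\<And>z w. z \<in> S \<Longrightarrow> w \<in> S \<Longrightarrow> cmod (f z w) \<le> B"
  shows "(\<lambda>z. f z z) holomorphic_on S"
proof -
  have "(\<lambda>z. f z z) field_differentiable at c" if c: "c \<in> S" for c
  proof -
    obtain r where r: "0 < r" "cball c r \<subseteq> S"
      using S c open_contains_cball by blast
    let ?g = "circlepath c r" and ?g' = "\<lambda>t. vector_derivative (circlepath c r) (at t)"
    have gS: "?g t \<in> S" if "t \<in> {0..1}" for t
      using r that path_image_circlepath_nonneg[of r c] unfolding path_image_def by force
    have gd: "r / 2 \<le> cmod (?g t - z)" if "z \<in> ball c (r/2)" for z t
    proof -
      have "cmod (?g t - c) = r"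
        using r by (simp add: circlepath norm_mult)
      moreover have "cmod (z - c) < r / 2"
        using that by (simp add: dist_norm norm_minus_commute)
      ultimately show ?thesis
        using norm_triangle_ineq[of "?g t - z" "z - c"] by simp
    qed
    have B0: "0 \<le> B" using bnd[OF c c] norm_ge_zero order_trans by blast
    let ?F = "\<lambda>z t. f z (?g t) / (?g t - z) * ?g' t"
    have "(\<lambda>z. integral {0..1} (?F z)) holomorphic_on ball c (r/2)"
    proof (rule holomorphic_on_integral_parameter[where B = "B / (r/2) * (2 * pi * r)"])
      fix t :: real assume t: "t \<in> {0..1}"
      have "?g t - z \<noteq> 0" if "z \<in> ball c (r/2)" for z
        using gd[OF that, of t] r by auto
      then show "(\<lambda>z. ?F z t) holomorphic_on ball c (r/2)"
        using r by (intro holomorphic_intros holomorphic_on_subset[OF hol1[OF gS[OF t]]]) auto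
    next
      fix z assume z: "z \<in> ball c (r/2)"
      then have "z \<in> S" using r by auto
      have nz: "?g t - z \<noteq> 0" for t
        using gd[OF z, of t] r by auto
      have cf: "continuous_on {0..1} (\<lambda>t. f z (?g t))"
        by (rule continuous_on_compose2[OF holomorphic_on_imp_continuous_on[OF hol2[OF \<open>z \<in> S\<close>]]])
           (use gS in \<open>auto simp: circlepath intro!: continuous_intros\<close>)
      have cg: "continuous_on {0..1} ?g"
        using path_circlepath path_def by blast
      show "continuous_on {0..1} (?F z)"
        using nz by (intro continuous_intros cf cg) (auto simp: vector_derivative_circlepath intro!: continuous_intros)
    next
      fix z and t :: real assume z: "z \<in> ball c (r/2)" and t: "t \<in> {0..1}"
      then have "z \<in> S" using r by auto
      have "cmod (f z (?g t) / (?g t - z)) \<le> B / (r/2)"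
        unfolding norm_divide using gd[OF z, of t] r B0 bnd[OF \<open>z \<in> S\<close> gS[OF t]]
        by (intro frac_le) auto
      moreover have "cmod (?g' t) = 2 * pi * r"
        using r by (simp add: vector_derivative_circlepath norm_mult)
      ultimately show "cmod (?F z t) \<le> B / (r/2) * (2 * pi * r)"
        unfolding norm_mult[of _ "?g' t"] using r B0 by (intro mult_mono) auto
    qed simp
    moreover have "integral {0..1} (?F z) = 2 * of_real pi * \<i> * f z z" if z: "z \<in> ball c (r/2)" for z
    proof -
      have "z \<in> S" "cmod (z - c) < r"
        using z r by (auto simp: dist_norm norm_minus_commute)
      have "((\<lambda>u. f z u / (u - z)) has_contour_integral 2 * of_real pi * \<i> * f z z) ?g"
        by (rule Cauchy_integral_circlepath_simple)
           (rule holomorphic_on_subset[OF hol2[OF \<open>z \<in> S\<close>] r(2)], fact)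
      from contour_integral_unique[OF this] show ?thesis
        unfolding contour_integral_integral .
    qed
    ultimately have "(\<lambda>z. 2 * of_real pi * \<i> * f z z) holomorphic_on ball c (r/2)"
      by (rule holomorphic_transform) simp
    from holomorphic_on_mult[OF holomorphic_on_const this, of "inverse (2 * of_real pi * \<i>)"]
    have "(\<lambda>z. f z z) holomorphic_on ball c (r/2)"
      by (rule holomorphic_transform) (simp add: field_simps)
    then show ?thesis
      using r(1) by (auto intro: holomorphic_on_imp_differentiable_at)
  qed
  then show ?thesis
    using holomorphic_on_def field_differentiable_at_within by blast
qed

text \<open>
  Banach's fixed point theorem for the norm \<open>sup |F| / W\<close>. The weight lies between positive constants,
  so convergence in this norm is uniform convergence and preserves boundedness and holomorphy.
\<close>

lemma bounded_holomorphic_fixed_point: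
  fixes T :: "(complex \<Rightarrow> complex) \<Rightarrow> complex \<Rightarrow> complex" and W :: "complex \<Rightarrow> real"
  assumes S: "open S" and q: "0 \<le> q" "q < 1"
    and W: "\<And>z. z \<in> S \<Longrightarrow> 1 \<le> W z" "\<And>z. z \<in> S \<Longrightarrow> W z \<le> W1"
    and maps: "\<And>F. F holomorphic_on S \<Longrightarrow> bounded (F ` S) \<Longrightarrow> T F holomorphic_on S \<and> bounded (T F ` S)"
    and contr: "\<And>F G M. F holomorphic_on S \<Longrightarrow> bounded (F ` S) \<Longrightarrow> G holomorphic_on S \<Longrightarrow>
      bounded (G ` S) \<Longrightarrow> (\<And>z. z \<in> S \<Longrightarrow> cmod (F z - G z) \<le> M * W z) \<Longrightarrow>
      (\<And>z. z \<in> S \<Longrightarrow> cmod (T F z - T G z) \<le> q * M * W z)"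
  shows "\<exists>U. U holomorphic_on S \<and> bounded (U ` S) \<and> (\<forall>z\<in>S. T U z = U z)"
proof -
  define F where "F n = (T ^^ n) (\<lambda>_. 0)" for n
  have FS: "F (Suc n) = T (F n)" for n by (simp add: F_def)
  have hb: "F n holomorphic_on S \<and> bounded (F n ` S)" for n
  proof (induction n)
    case 0
    show ?case by (auto simp: F_def bounded_iff)
  next
    case (Suc n)
    then show ?case using maps FS by simp
  qed
  obtain M where M: "\<And>z. z \<in> S \<Longrightarrow> cmod (F 1 z) \<le> M" "0 \<le> M"
    using hb[of 1] unfolding bounded_iff by (metis abs_ge_self abs_ge_zero image_eqI order_trans)
  have step: "cmod (F (Suc n) z - F n z) \<le> M * q ^ n * W z" if "z \<in> S" for n z
    using that
  proof (induction n arbitrary: z)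
    case 0
    have "cmod (F 1 z) \<le> M * 1" using M 0 by simp
    also have "\<dots> \<le> M * W z" using M W 0 by (intro mult_left_mono) auto
    finally show ?case by (simp add: F_def)
  next
    case (Suc n)
    have "cmod (T (F (Suc n)) z - T (F n) z) \<le> q * (M * q ^ n) * W z"
      by (rule contr) (use hb Suc in auto)
    then show ?case by (simp add: FS mult_ac)
  qed
  have dist: "cmod (F (n + k) z - F n z) \<le> M * q ^ n / (1 - q) * W z" if "z \<in> S" for n k z
  proof -
    have "cmod (F (n + k) z - F n z) \<le> M * W z * (q ^ n * (\<Sum>i<k. q ^ i))"
    proof (induction k)
      case (Suc k)
      have "cmod (F (n + Suc k) z - F n z)
          \<le> cmod (F (Suc (n + k)) z - F (n + k) z) + cmod (F (n + k) z - F n z)"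
        using norm_triangle_ineq[of "F (Suc (n + k)) z - F (n + k) z" "F (n + k) z - F n z"] by simp
      also have "\<dots> \<le> M * W z * (q ^ n * (\<Sum>i<Suc k. q ^ i))"
        using Suc step[OF that, of "n + k"] by (simp add: algebra_simps power_add)
      finally show ?case .
    qed simp
    also have "\<dots> \<le> M * W z * (q ^ n * (1 / (1 - q)))"
    proof -
      have "(\<Sum>i<k. q ^ i) \<le> 1 / (1 - q)"
        using q by (simp add: sum_gp_strict divide_right_mono)
      then show ?thesis
        using W(1)[OF that] M q by (intro mult_left_mono) auto
    qed
    finally show ?thesis by (simp add: mult_ac)
  qed
  have tail: "(\<lambda>n. M * q ^ n / (1 - q) * w) \<longlonglongrightarrow> 0" for w
    using q by (intro tendsto_eq_intros LIMSEQ_realpow_zero) auto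
  have "Cauchy (\<lambda>n. F n z)" if z: "z \<in> S" for z
  proof (rule metric_CauchyI)
    fix e :: real assume e: "0 < e"
    have "eventually (\<lambda>n. M * q ^ n / (1 - q) * W z < e) sequentially"
      using order_tendstoD(2)[OF tail e] .
    moreover have "eventually (\<lambda>n. M * q ^ n / (1 - q) * W z < e / 2) sequentially"
      using order_tendstoD(2)[OF tail, of "e/2"] e by auto
    ultimately obtain N where N: "M * q ^ N / (1 - q) * W z < e / 2"
      using eventually_happens by force
    have close: "dist (F m z) (F N z) < e / 2" if "m \<ge> N" for m
      using le_less_trans[OF dist[OF z, of N "m - N"] N] that by (simp add: dist_norm)
    show "\<exists>N. \<forall>m\<ge>N. \<forall>n\<ge>N. dist (F m z) (F n z) < e"
    proof (intro exI[of _ N] allI impI)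
      fix m n assume "N \<le> m" "N \<le> n"
      then show "dist (F m z) (F n z) < e"
        using close[of m] close[of n] dist_triangle_half_l[of "F m z" "F N z" e "F n z"]
        by (simp add: dist_commute)
    qed
  qed
  then have "\<exists>l. z \<in> S \<longrightarrow> (\<lambda>n. F n z) \<longlonglongrightarrow> l" for z
    by (metis Cauchy_convergent_iff convergent_def)
  then obtain U where lim: "\<And>z. z \<in> S \<Longrightarrow> (\<lambda>n. F n z) \<longlonglongrightarrow> U z"
    by metis
  have distU: "cmod (U z - F n z) \<le> M * q ^ n / (1 - q) * W z" if "z \<in> S" for n z
  proof (rule LIMSEQ_le_const2)
    show "(\<lambda>k. cmod (F (n + k) z - F n z)) \<longlonglongrightarrow> cmod (U z - F n z)"
      by (intro tendsto_intros) (use LIMSEQ_ignore_initial_segment[OF lim[OF that], of n] in \<open>simp add: add.commute\<close>)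
  qed (use dist that in auto)
  have bF: "cmod (F n z) \<le> M / (1 - q) * W1" if "z \<in> S" for n z
  proof -
    have "cmod (F (0 + n) z - F 0 z) \<le> M * q ^ 0 / (1 - q) * W z"
      by (rule dist[OF that])
    also have "\<dots> \<le> M / (1 - q) * W1"
      using M q W(2)[OF that] by (simp add: divide_right_mono mult_left_mono)
    finally show ?thesis by (simp add: F_def)
  qed
  have Uhol: "U holomorphic_on S"
    by (rule holomorphic_on_pointwise_limit[OF S _ bF lim]) (use hb in auto)
  have Ubd: "bounded (U ` S)"
  proof -
    have "cmod (U z) \<le> M / (1 - q) * W1" if "z \<in> S" for z
      using LIMSEQ_le_const2[OF tendsto_norm[OF lim[OF that]]] bF[OF that] by blast
    then show ?thesis unfolding bounded_iff by blast
  qed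
  have "T U z = U z" if z: "z \<in> S" for z
  proof -
    have "cmod (T U z - F (Suc n) z) \<le> q * (M * q ^ n / (1 - q)) * W z" for n
      unfolding FS by (rule contr) (use hb Uhol Ubd distU z in auto)
    then have le: "cmod (T U z - F (Suc n) z) \<le> M * q ^ Suc n / (1 - q) * W z" for n
      by (simp add: mult_ac)
    have "(\<lambda>n. T U z - F (Suc n) z) \<longlonglongrightarrow> 0"
      by (rule Lim_null_comparison[OF _ LIMSEQ_Suc[OF tail[of "W z"]]]) (use le in auto)
    moreover have "(\<lambda>n. T U z - F (Suc n) z) \<longlonglongrightarrow> T U z - U z"
      by (intro tendsto_intros LIMSEQ_Suc[OF lim[OF z]])
    ultimately show ?thesis
      using LIMSEQ_unique by force
  qed
  with Uhol Ubd show ?thesis by blast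
qed

section \<open>Primitives on the strip that vanish at the left end\<close>

lemma open_strip: "open (strip d)"
proof -
  have "strip d = {\<zeta>. -d < Im \<zeta>} \<inter> {\<zeta>. Im \<zeta> < d}"
    unfolding strip_def by auto
  then show ?thesis
    by (simp add: open_halfspace_Im_gt open_halfspace_Im_lt open_Int)
qed

lemma convex_strip: "convex (strip d)"
proof -
  have "strip d = {\<zeta>. -d < Im \<zeta>} \<inter> {\<zeta>. Im \<zeta> < d}"
    unfolding strip_def by auto
  then show ?thesis
    by (simp add: convex_halfspace_Im_gt convex_halfspace_Im_lt convex_Int)
qed

lemma of_real_in_strip [simp]: "0 < d \<Longrightarrow> of_real x \<in> strip d"
  by (simp add: strip_def)

text \<open>
  The primitive of \<open>1 / cosh\<close> that vanishes at \<open>-\<infinity>\<close>, a translate of the Gudermannian function.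
\<close>

definition gudermann :: "real \<Rightarrow> real" where
  "gudermann x = arctan (sinh x) + pi / 2"

lemma gudermann_has_derivative: "(gudermann has_real_derivative 1 / cosh x) (at x)"
proof -
  have "(gudermann has_real_derivative inverse (1 + (sinh x)\<^sup>2) * cosh x) (at x)"
    unfolding gudermann_def by (rule derivative_eq_intros refl | simp)+
  moreover have "inverse (1 + (sinh x)\<^sup>2) * cosh x = 1 / cosh x"
  proof -
    have "1 + (sinh x)\<^sup>2 = (cosh x)\<^sup>2" by (simp add: cosh_square_eq)
    then show ?thesis by (simp add: power2_eq_square field_simps)
  qed
  ultimately show ?thesis by simp
qed

lemma gudermann_pos: "0 < gudermann x"
  using arctan_lbound[of "sinh x"] by (simp add: gudermann_def)

lemma gudermann_less_pi: "gudermann x < pi"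
  using arctan_ubound[of "sinh x"] by (simp add: gudermann_def)

lemma gudermann_tendsto_0: "(gudermann \<longlongrightarrow> 0) at_bot"
proof -
  have "((\<lambda>x::real. arctan (sinh x)) \<longlongrightarrow> - (pi / 2)) at_bot"
    by (rule filterlim_compose[OF tendsto_arctan_at_bot sinh_real_at_bot])
  from tendsto_add[OF this tendsto_const[of "pi/2"]] show ?thesis
    unfolding gudermann_def by simp
qed

text \<open>
  For decaying \<open>F\<close> this characterises \<open>G \<zeta>\<close> as the integral of \<open>F\<close> from \<open>-\<infinity>\<close> to \<open>\<zeta>\<close>. The limit
  is prescribed along the real axis; along every other horizontal line it is then the same.
\<close>

definition left_primitive :: "real \<Rightarrow> (complex \<Rightarrow> complex) \<Rightarrow> (complex \<Rightarrow> complex) \<Rightarrow> bool" where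
  "left_primitive d F G \<longleftrightarrow> (\<forall>\<zeta>\<in>strip d. (G has_field_derivative F \<zeta>) (at \<zeta>)) \<and>
     ((\<lambda>x. G (of_real x)) \<longlongrightarrow> 0) at_bot"

definition decaying :: "real \<Rightarrow> (complex \<Rightarrow> complex) \<Rightarrow> bool" where
  "decaying d F \<longleftrightarrow> F holomorphic_on strip d \<and> (\<exists>C. \<forall>\<zeta>\<in>strip d. cmod (F \<zeta>) \<le> C / cosh (Re \<zeta>))"

lemma decayingI:
  "F holomorphic_on strip d \<Longrightarrow> (\<And>\<zeta>. \<zeta> \<in> strip d \<Longrightarrow> cmod (F \<zeta>) \<le> C / cosh (Re \<zeta>)) \<Longrightarrow> decaying d F"
  unfolding decaying_def by blast

lemma decaying_diff: "decaying d F \<Longrightarrow> decaying d G \<Longrightarrow> decaying d (\<lambda>\<zeta>. F \<zeta> - G \<zeta>)"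
proof -
  assume "decaying d F" "decaying d G"
  then obtain C D where F: "F holomorphic_on strip d" "\<And>\<zeta>. \<zeta> \<in> strip d \<Longrightarrow> cmod (F \<zeta>) \<le> C / cosh (Re \<zeta>)"
    and G: "G holomorphic_on strip d" "\<And>\<zeta>. \<zeta> \<in> strip d \<Longrightarrow> cmod (G \<zeta>) \<le> D / cosh (Re \<zeta>)"
    unfolding decaying_def by blast
  show ?thesis
  proof (rule decayingI[where C = "C + D"])
    fix \<zeta> assume "\<zeta> \<in> strip d"
    then show "cmod (F \<zeta> - G \<zeta>) \<le> (C + D) / cosh (Re \<zeta>)"
      using norm_triangle_ineq4[of "F \<zeta>" "G \<zeta>"] F(2)[of \<zeta>] G(2)[of \<zeta>] by (simp add: add_divide_distrib)
  qed (intro holomorphic_intros F G)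
qed

lemma left_primitive_diff: "left_primitive d F G \<Longrightarrow> left_primitive d F' G' \<Longrightarrow> left_primitive d (\<lambda>\<zeta>. F \<zeta> - F' \<zeta>) (\<lambda>\<zeta>. G \<zeta> - G' \<zeta>)"
  unfolding left_primitive_def by (auto intro: derivative_intros tendsto_eq_intros)

lemma left_primitive_holomorphic: "left_primitive d F G \<Longrightarrow> G holomorphic_on strip d"
  unfolding left_primitive_def holomorphic_on_def
  using field_differentiable_at_within field_differentiable_def by blast

lemma left_primitive_cong:
  assumes "0 < d" "left_primitive d F G" "\<And>\<zeta>. \<zeta> \<in> strip d \<Longrightarrow> G \<zeta> = G' \<zeta>"
  shows "left_primitive d F G'"
proof -
  have "(G' has_field_derivative F \<zeta>) (at \<zeta>)" if "\<zeta> \<in> strip d" for \<zeta>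
    using assms that open_strip has_field_derivative_transform_within_open
    unfolding left_primitive_def by blast
  then show ?thesis
    using assms by (simp add: left_primitive_def)
qed

text \<open>
  The mean value inequality along a horizontal segment: it replaces all estimates of integrals
  on the strip.
\<close>

lemma horizontal_increment_bound:
  assumes der: "\<And>\<zeta>. \<zeta> \<in> strip d \<Longrightarrow> (G has_field_derivative F \<zeta>) (at \<zeta>)"
    and bnd: "\<And>\<zeta>. \<zeta> \<in> strip d \<Longrightarrow> cmod (F \<zeta>) \<le> \<phi>' (Re \<zeta>)"
    and \<phi>: "\<And>x. (\<phi> has_real_derivative \<phi>' x) (at x)"
    and y: "\<bar>y\<bar> < d" and x: "x0 \<le> x"
  shows "cmod (G (Complex x y) - G (Complex x0 y)) \<le> \<phi> x - \<phi> x0"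
proof (cases "x0 = x")
  case False
  have inS: "Complex t y \<in> strip d" for t using y by (simp add: strip_def)
  have vd: "((\<lambda>t. G (Complex t y)) has_vector_derivative F (Complex t y)) (at t)" for t
  proof -
    have "((\<lambda>t. Complex t y) has_vector_derivative 1) (at t)"
      unfolding Complex_eq by (auto intro!: derivative_eq_intros)
    from field_vector_diff_chain_at[OF this der[OF inS]] show ?thesis
      by (simp add: o_def)
  qed
  show ?thesis
  proof (rule differentiable_bound_general[where f' = "\<lambda>t. F (Complex t y)" and \<phi>' = \<phi>'])
    show "continuous_on {x0..x} (\<lambda>t. G (Complex t y))"
      using vd by (meson continuous_at_imp_continuous_on has_vector_derivative_continuous)
    show "continuous_on {x0..x} \<phi>"
      using \<phi> by (meson DERIV_isCont continuous_at_imp_continuous_on)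
    show "(\<phi> has_vector_derivative \<phi>' t) (at t)" for t
      using \<phi> has_real_derivative_iff_has_vector_derivative by blast
    show "cmod (F (Complex t y)) \<le> \<phi>' t" for t
      using bnd[OF inS, of t] by simp
  qed (use False x vd in auto)
qed simp

text \<open>
  A convex domain admits some primitive \<open>G\<close>; domination of its increments by those of
  \<open>C gudermann\<close>, which converges at \<open>-\<infinity>\<close>, shows that \<open>G\<close> has a limit there, and this limit is subtracted.
\<close>

lemma left_primitive_exists:
  assumes d: "0 < d" and F: "decaying d F"
  shows "\<exists>G. left_primitive d F G"
proof -
  obtain C where C: "\<And>\<zeta>. \<zeta> \<in> strip d \<Longrightarrow> cmod (F \<zeta>) \<le> C / cosh (Re \<zeta>)"
    and hol: "F holomorphic_on strip d"
    using F unfolding decaying_def by blast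
  obtain G where G': "\<And>\<zeta>. \<zeta> \<in> strip d \<Longrightarrow> (G has_field_derivative F \<zeta>) (at \<zeta> within strip d)"
    using holomorphic_convex_primitive'[OF convex_strip open_strip hol] by blast
  have G: "(G has_field_derivative F \<zeta>) (at \<zeta>)" if "\<zeta> \<in> strip d" for \<zeta>
    using G'[OF that] at_within_open[OF that open_strip] by simp
  have mono: "cmod (G (of_real x) - G (of_real x0)) \<le> C * gudermann x - C * gudermann x0" if "x0 \<le> x" for x x0
  proof -
    have "((\<lambda>x. C * gudermann x) has_real_derivative C / cosh x) (at x)" for x
      using DERIV_cmult[OF gudermann_has_derivative, of C x] by simp
    with horizontal_increment_bound[OF G, where \<phi>' = "\<lambda>x. C / cosh x" and \<phi> = "\<lambda>x. C * gudermann x"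
        and y = 0] show ?thesis
      using C d that by (simp add: complex_of_real_def[symmetric])
  qed
  have inc: "cmod (G (of_real x) - G (of_real x0)) \<le> \<bar>C * gudermann x - C * gudermann x0\<bar>" for x x0
    using mono[of x x0] mono[of x0 x] by (cases "x0 \<le> x") (auto simp: norm_minus_commute)
  define X where "X n = - real n" for n :: nat
  have Xb: "filterlim X at_bot sequentially"
    unfolding X_def using filterlim_real_sequentially filterlim_uminus_at_bot by force
  have Ag: "(\<lambda>n. C * gudermann (X n)) \<longlonglongrightarrow> 0"
    using tendsto_mult_right_zero[OF filterlim_compose[OF gudermann_tendsto_0 Xb]] .
  have "Cauchy (\<lambda>n. G (of_real (X n)))"
  proof (rule metric_CauchyI)
    fix e :: real assume "0 < e"
    then obtain N where N: "\<And>m n. m \<ge> N \<Longrightarrow> n \<ge> N \<Longrightarrow> dist (C * gudermann (X m)) (C * gudermann (X n)) < e"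
      using LIMSEQ_imp_Cauchy[OF Ag] unfolding Cauchy_def by metis
    show "\<exists>M. \<forall>m\<ge>M. \<forall>n\<ge>M. dist (G (of_real (X m))) (G (of_real (X n))) < e"
      using le_less_trans[OF inc] N unfolding dist_norm real_norm_def by blast
  qed
  then obtain L where L: "(\<lambda>n. G (of_real (X n))) \<longlonglongrightarrow> L"
    using Cauchy_convergent convergent_def by blast
  have close: "cmod (G (of_real x) - L) \<le> \<bar>C * gudermann x\<bar>" for x
  proof (rule LIMSEQ_le)
    show "(\<lambda>n. cmod (G (of_real x) - G (of_real (X n)))) \<longlonglongrightarrow> cmod (G (of_real x) - L)"
      by (intro tendsto_intros L)
    show "(\<lambda>n. \<bar>C * gudermann x - C * gudermann (X n)\<bar>) \<longlonglongrightarrow> \<bar>C * gudermann x\<bar>"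
      using tendsto_rabs[OF tendsto_diff[OF tendsto_const Ag, of "C * gudermann x"]] by simp
  qed (use inc in auto)
  have "((\<lambda>x. G (of_real x) - L) \<longlongrightarrow> 0) at_bot"
  proof (rule Lim_null_comparison)
    show "((\<lambda>x. \<bar>C * gudermann x\<bar>) \<longlongrightarrow> 0) at_bot"
      using tendsto_rabs[OF tendsto_mult_right_zero[OF gudermann_tendsto_0, of C]] by simp
  qed (use close in auto)
  moreover have "((\<lambda>\<zeta>. G \<zeta> - L) has_field_derivative F \<zeta>) (at \<zeta>)" if "\<zeta> \<in> strip d" for \<zeta>
    using G[OF that] by (auto intro!: derivative_eq_intros)
  ultimately have "left_primitive d F (\<lambda>\<zeta>. G \<zeta> - L)"
    by (simp add: left_primitive_def)
  then show ?thesis by blast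
qed

text \<open>
  On a vertical segment over \<open>x\<close> the integrand is at most \<open>C / cosh x\<close>, so \<open>G\<close> is asymptotically
  constant along these segments.
\<close>

lemma left_primitive_horizontal_tendsto_0:
  assumes d: "0 < d" and F: "decaying d F" and G: "left_primitive d F G" and y: "\<bar>y\<bar> < d"
  shows "((\<lambda>x. G (Complex x y)) \<longlongrightarrow> 0) at_bot"
proof -
  obtain C where C: "\<And>\<zeta>. \<zeta> \<in> strip d \<Longrightarrow> cmod (F \<zeta>) \<le> C / cosh (Re \<zeta>)"
    using F unfolding decaying_def by blast
  have near: "cmod (G (Complex x y) - G (of_real x)) \<le> C / cosh x * \<bar>y\<bar>" for x
  proof -
    have seg: "closed_segment (of_real x) (Complex x y) \<subseteq> strip d \<inter> {z. Re z = x}"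
    proof (rule closed_segment_subset)
      have "{z. Re z = x} = {z. inner 1 z = x}" by auto
      then show "convex (strip d \<inter> {z. Re z = x})"
        by (metis convex_Int convex_hyperplane convex_strip)
    qed (use d y in \<open>auto simp: strip_def\<close>)
    have "cmod (G (Complex x y) - G (of_real x)) \<le> C / cosh x * cmod (Complex x y - of_real x)"
    proof (rule field_differentiable_bound[OF convex_closed_segment])
      fix z assume "z \<in> closed_segment (of_real x) (Complex x y)"
      then have z: "z \<in> strip d" "Re z = x" using seg by auto
      show "(G has_field_derivative F z) (at z within closed_segment (of_real x) (Complex x y))"
        using G z(1) has_field_derivative_at_within unfolding left_primitive_def by blast
      show "cmod (F z) \<le> C / cosh x" using C z by blast
    qed auto
    moreover have "Complex x y - of_real x = \<i> * of_real y"
      by (simp add: complex_eq_iff)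
    ultimately show ?thesis by (simp add: norm_mult)
  qed
  have "((\<lambda>x. C / cosh x * \<bar>y\<bar>) \<longlongrightarrow> 0) at_bot"
    by (intro tendsto_mult_left_zero tendsto_divide_0[OF tendsto_const]
          filterlim_at_top_imp_at_infinity cosh_real_at_bot)
  then have "((\<lambda>x. G (Complex x y) - G (of_real x)) \<longlongrightarrow> 0) at_bot"
    by (rule Lim_null_comparison[rotated]) (use near in auto)
  from tendsto_add[OF this] G show ?thesis
    unfolding left_primitive_def by fastforce
qed

lemma left_primitive_bound:
  assumes d: "0 < d" and F: "decaying d F" and G: "left_primitive d F G"
    and bnd: "\<And>\<zeta>. \<zeta> \<in> strip d \<Longrightarrow> cmod (F \<zeta>) \<le> \<phi>' (Re \<zeta>)"
    and \<phi>: "\<And>x. (\<phi> has_real_derivative \<phi>' x) (at x)" "\<And>x. 0 \<le> \<phi> x"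
    and \<zeta>: "\<zeta> \<in> strip d"
  shows "cmod (G \<zeta>) \<le> \<phi> (Re \<zeta>)"
proof (rule tendsto_upperbound)
  have y: "\<bar>Im \<zeta>\<bar> < d" using \<zeta> by (simp add: strip_def)
  have "((\<lambda>x0. G \<zeta> - G (Complex x0 (Im \<zeta>))) \<longlongrightarrow> G \<zeta> - 0) at_bot"
    by (intro tendsto_intros left_primitive_horizontal_tendsto_0[OF d F G y])
  then show "((\<lambda>x0. cmod (G \<zeta> - G (Complex x0 (Im \<zeta>)))) \<longlongrightarrow> cmod (G \<zeta>)) at_bot"
    using tendsto_norm by fastforce
  show "\<forall>\<^sub>F x0 in at_bot. cmod (G \<zeta> - G (Complex x0 (Im \<zeta>))) \<le> \<phi> (Re \<zeta>)"
    using eventually_le_at_bot[of "Re \<zeta>"]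
  proof eventually_elim
    fix x0 assume "x0 \<le> Re \<zeta>"
    then have "cmod (G (Complex (Re \<zeta>) (Im \<zeta>)) - G (Complex x0 (Im \<zeta>))) \<le> \<phi> (Re \<zeta>) - \<phi> x0"
      using G bnd \<phi>(1) y by (intro horizontal_increment_bound[where F = F and \<phi>' = \<phi>'])
        (auto simp: left_primitive_def)
    then show "cmod (G \<zeta> - G (Complex x0 (Im \<zeta>))) \<le> \<phi> (Re \<zeta>)"
      using \<phi>(2)[of x0] by simp
  qed
qed simp

lemma left_primitive_bound_pi:
  assumes d: "0 < d" and F: "F holomorphic_on strip d" and G: "left_primitive d F G"
    and bnd: "\<And>\<zeta>. \<zeta> \<in> strip d \<Longrightarrow> cmod (F \<zeta>) \<le> C / cosh (Re \<zeta>)" and \<zeta>: "\<zeta> \<in> strip d"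
  shows "cmod (G \<zeta>) \<le> C * pi"
proof -
  have "0 \<le> C / cosh (Re \<zeta>)" using bnd[OF \<zeta>] norm_ge_zero order_trans by blast
  then have C: "0 \<le> C" using cosh_real_pos[of "Re \<zeta>"] by (simp add: zero_le_divide_iff not_le[symmetric])
  have "cmod (G \<zeta>) \<le> C * gudermann (Re \<zeta>)"
  proof (rule left_primitive_bound[OF d decayingI[OF F bnd] G bnd _ _ \<zeta>])
    show "((\<lambda>x. C * gudermann x) has_real_derivative C / cosh x) (at x)" for x
      using DERIV_cmult[OF gudermann_has_derivative, of C x] by simp
  qed (simp_all add: mult_nonneg_nonneg[OF C less_imp_le[OF gudermann_pos]])
  also have "\<dots> \<le> C * pi"
    using C gudermann_less_pi by (intro mult_left_mono) (auto intro: less_imp_le)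
  finally show ?thesis .
qed

text \<open>
  Chosen so that \<open>C / cosh\<close> times the weight is the derivative of half the weight along
  horizontal lines: each integration against \<open>C / cosh\<close> gains a factor \<open>1/2\<close>.
\<close>

definition weight :: "real \<Rightarrow> complex \<Rightarrow> real" where
  "weight C \<zeta> = exp (2 * C * gudermann (Re \<zeta>))"

lemma left_primitive_bound_weight:
  assumes d: "0 < d" and F: "decaying d F" and G: "left_primitive d F G" and M: "0 \<le> M" and \<zeta>: "\<zeta> \<in> strip d"
    and bnd: "\<And>\<zeta>. \<zeta> \<in> strip d \<Longrightarrow> cmod (F \<zeta>) \<le> C / cosh (Re \<zeta>) * (M * weight C \<zeta>)"
  shows "cmod (G \<zeta>) \<le> M / 2 * weight C \<zeta>"
  unfolding weight_def
proof (rule left_primitive_bound[OF d F G _ _ _ \<zeta>, where \<phi> = "\<lambda>x. M / 2 * exp (2 * C * gudermann x)"])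
  show "((\<lambda>x. M / 2 * exp (2 * C * gudermann x)) has_real_derivative
           C / cosh x * (M * exp (2 * C * gudermann x))) (at x)" for x
    by (rule derivative_eq_intros gudermann_has_derivative refl | simp)+
qed (use bnd M in \<open>auto simp: weight_def\<close>)

lemma left_primitive_contour_integral:
  assumes "left_primitive d F G" "z \<in> strip d" "w \<in> strip d"
  shows "(F has_contour_integral (G w - G z)) (linepath z w)"
proof -
  have "(F has_contour_integral (G (pathfinish (linepath z w)) - G (pathstart (linepath z w)))) (linepath z w)"
  proof (rule contour_integral_primitive)
    show "path_image (linepath z w) \<subseteq> strip d"
      using closed_segment_subset[OF assms(2,3) convex_strip] by simp
    show "(G has_field_derivative F \<zeta>) (at \<zeta> within strip d)" if "\<zeta> \<in> strip d" for \<zeta>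
      using assms(1) that has_field_derivative_at_within unfolding left_primitive_def by blast
  qed simp
  then show ?thesis by simp
qed

text \<open>
  For a fixed end point \<open>w\<close>, \<open>P \<zeta> w\<close> is the limit of integrals over segments from \<open>-n\<close> to \<open>w\<close>, which
  are holomorphic in the parameter \<open>\<zeta>\<close>. Hence \<open>P\<close> is separately holomorphic and bounded, and its
  diagonal is holomorphic.
\<close>

lemma volterra_diagonal_holomorphic:
  fixes \<kappa> P :: "complex \<Rightarrow> complex \<Rightarrow> complex"
  assumes d: "0 < d"
    and hol1: "\<And>\<omega>. \<omega> \<in> strip d \<Longrightarrow> (\<lambda>\<zeta>. \<kappa> \<zeta> \<omega>) holomorphic_on strip d"
    and hol2: "\<And>\<zeta>. \<zeta> \<in> strip d \<Longrightarrow> \<kappa> \<zeta> holomorphic_on strip d"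
    and bnd: "\<And>\<zeta> \<omega>. \<zeta> \<in> strip d \<Longrightarrow> \<omega> \<in> strip d \<Longrightarrow> cmod (\<kappa> \<zeta> \<omega>) \<le> C / cosh (Re \<omega>)"
    and P: "\<And>\<zeta>. \<zeta> \<in> strip d \<Longrightarrow> left_primitive d (\<kappa> \<zeta>) (P \<zeta>)"
  shows "(\<lambda>\<zeta>. P \<zeta> \<zeta>) holomorphic_on strip d"
proof (rule holomorphic_on_diagonal[OF open_strip, where f = P])
  have bP: "cmod (P \<zeta> \<omega>) \<le> C * pi" if "\<zeta> \<in> strip d" "\<omega> \<in> strip d" for \<zeta> \<omega>
    using left_primitive_bound_pi[OF d hol2[OF that(1)] P[OF that(1)] bnd[OF that(1)] that(2)] .
  then show "cmod (P \<zeta> \<omega>) \<le> C * pi" if "\<zeta> \<in> strip d" "\<omega> \<in> strip d" for \<zeta> \<omega>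
    using that by blast
  show "P \<zeta> holomorphic_on strip d" if "\<zeta> \<in> strip d" for \<zeta>
    using P left_primitive_holomorphic that by blast
  fix w assume w: "w \<in> strip d"
  define X where "X n = - real n" for n :: nat
  have Xb: "filterlim X at_bot sequentially"
    unfolding X_def using filterlim_real_sequentially filterlim_uminus_at_bot by force
  let ?I = "\<lambda>n \<zeta>. integral {0..1} (\<lambda>t. \<kappa> \<zeta> (linepath (of_real (X n)) w t) * (w - of_real (X n)))"
  have I: "?I n \<zeta> = P \<zeta> w - P \<zeta> (of_real (X n))" if "\<zeta> \<in> strip d" for n \<zeta>
    using left_primitive_contour_integral[OF P[OF that] of_real_in_strip[OF d] w]
    by (intro integral_unique) (simp add: has_contour_integral_linepath)
  show "(\<lambda>\<zeta>. P \<zeta> w) holomorphic_on strip d"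
  proof (rule holomorphic_on_pointwise_limit[OF open_strip, where f = ?I])
    show "?I n holomorphic_on strip d" for n
    proof (rule holomorphic_on_integral_parameter[OF open_strip])
      have seg: "linepath (of_real (X n)) w t \<in> strip d" if "t \<in> {0..1}" for t
        using closed_segment_subset[OF _ w convex_strip, of "of_real (X n)"] linepath_in_path[OF that] d
        by auto
      show "(\<lambda>\<zeta>. \<kappa> \<zeta> (linepath (of_real (X n)) w t) * (w - of_real (X n))) holomorphic_on strip d"
        if "t \<in> {0..1}" for t
        by (intro holomorphic_intros hol1 seg that)
      show "continuous_on {0..1} (\<lambda>t. \<kappa> \<zeta> (linepath (of_real (X n)) w t) * (w - of_real (X n)))"
        if "\<zeta> \<in> strip d" for \<zeta>
        by (intro continuous_intros continuous_on_compose2[OF holomorphic_on_imp_continuous_on[OF hol2[OF that]]])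
           (use seg in auto)
      show "cmod (\<kappa> \<zeta> (linepath (of_real (X n)) w t) * (w - of_real (X n))) \<le> \<bar>C\<bar> * cmod (w - of_real (X n))"
        if "\<zeta> \<in> strip d" "t \<in> {0..1}" for \<zeta> t
      proof -
        have "cmod (\<kappa> \<zeta> (linepath (of_real (X n)) w t)) \<le> \<bar>C\<bar> / cosh (Re (linepath (of_real (X n)) w t))"
          by (rule order_trans[OF bnd[OF that(1) seg[OF that(2)]]]) (simp add: divide_right_mono)
        also have "\<dots> \<le> \<bar>C\<bar> / 1"
          by (intro divide_left_mono) (auto simp: cosh_real_ge_1)
        finally show ?thesis
          by (simp add: norm_mult mult_right_mono)
      qed
    qed
    show "cmod (?I n \<zeta>) \<le> 2 * (C * pi)" if "\<zeta> \<in> strip d" for n \<zeta>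
      unfolding I[OF that]
      using norm_triangle_ineq4[of "P \<zeta> w" "P \<zeta> (of_real (X n))"] bP[OF that w]
        bP[OF that of_real_in_strip[OF d], of "X n"] by linarith
    show "(\<lambda>n. ?I n \<zeta>) \<longlonglongrightarrow> P \<zeta> w" if "\<zeta> \<in> strip d" for \<zeta>
    proof -
      have "(\<lambda>n. P \<zeta> (of_real (X n))) \<longlonglongrightarrow> 0"
        using P[OF that] filterlim_compose[OF _ Xb] unfolding left_primitive_def by blast
      from tendsto_diff[OF tendsto_const this, of "P \<zeta> w"] show ?thesis
        by (simp only: I[OF that] diff_0_right)
    qed
  qed
qed

section \<open>The Volterra equation on the strip\<close>

text \<open>
  The coefficients stand for \<open>p = \<psi>'\<close>, \<open>G = g \<psi>'\<close>, \<open>m = \<mu> \<psi>'\<close> and \<open>\<kappa>(\<zeta>,\<omega>) = k(\<zeta>,\<omega>) \<psi>'(\<omega>)\<close>.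
  If \<open>|F - H| \<le> M weight\<close>, then the two inner integrals differ by at most \<open>M/2\<close> times the weight, so the
  integrands of the outer integral differ by at most \<open>C / cosh\<close> times \<open>(1 + 1/2) M weight\<close>, and the
  outer integrals by \<open>3/4 M weight\<close>.
\<close>

lemma volterra_equation_strip:
  fixes p G m :: "complex \<Rightarrow> complex" and \<kappa> :: "complex \<Rightarrow> complex \<Rightarrow> complex"
  assumes d: "0 < d" and C: "0 < C"
    and hol: "p holomorphic_on strip d" "G holomorphic_on strip d" "m holomorphic_on strip d"
    and \<kappa>1: "\<And>\<omega>. \<omega> \<in> strip d \<Longrightarrow> (\<lambda>\<zeta>. \<kappa> \<zeta> \<omega>) holomorphic_on strip d"
    and \<kappa>2: "\<And>\<zeta>. \<zeta> \<in> strip d \<Longrightarrow> \<kappa> \<zeta> holomorphic_on strip d"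
    and p: "\<And>\<zeta>. \<zeta> \<in> strip d \<Longrightarrow> cmod (p \<zeta>) \<le> C / cosh (Re \<zeta>)"
    and G: "\<And>\<zeta>. \<zeta> \<in> strip d \<Longrightarrow> cmod (G \<zeta>) \<le> C / cosh (Re \<zeta>)"
    and m: "\<And>\<zeta>. \<zeta> \<in> strip d \<Longrightarrow> cmod (m \<zeta>) \<le> C / cosh (Re \<zeta>)"
    and \<kappa>: "\<And>\<zeta> \<omega>. \<zeta> \<in> strip d \<Longrightarrow> \<omega> \<in> strip d \<Longrightarrow> cmod (\<kappa> \<zeta> \<omega>) \<le> C / cosh (Re \<omega>)"
  shows "\<exists>U V P. U holomorphic_on strip d \<and> bounded (U ` strip d) \<and>
    V holomorphic_on strip d \<and> bounded (V ` strip d) \<and>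
    (\<forall>\<zeta>\<in>strip d. left_primitive d (\<lambda>\<omega>. \<kappa> \<zeta> \<omega> * U \<omega>) (P \<zeta>) \<and> V \<zeta> = P \<zeta> \<zeta>) \<and>
    left_primitive d (\<lambda>\<zeta>. G \<zeta> + m \<zeta> * U \<zeta> + V \<zeta> * p \<zeta>) (\<lambda>\<zeta>. U \<zeta> - ua)"
proof -
  define I where "I F = (SOME G. left_primitive d F G)" for F
  have I: "left_primitive d F (I F)" if "decaying d F" for F
    unfolding I_def using someI_ex[OF left_primitive_exists[OF d that]] .
  define V where "V F \<zeta> = I (\<lambda>\<omega>. \<kappa> \<zeta> \<omega> * F \<omega>) \<zeta>" for F \<zeta>
  define E where "E F \<zeta> = G \<zeta> + m \<zeta> * F \<zeta> + V F \<zeta> * p \<zeta>" for F \<zeta>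
  define T where "T F \<zeta> = ua + I (E F) \<zeta>" for F \<zeta>
  have bound: "\<exists>B\<ge>0. \<forall>\<zeta>\<in>strip d. cmod (F \<zeta>) \<le> B" if "bounded (F ` strip d)" for F
    using that unfolding bounded_iff by (metis abs_ge_self abs_ge_zero image_eqI order_trans)
  have kF: "cmod (\<kappa> \<zeta> \<omega> * F \<omega>) \<le> (C * B) / cosh (Re \<omega>)"
    if "\<forall>\<zeta>\<in>strip d. cmod (F \<zeta>) \<le> B" "0 \<le> B" "\<zeta> \<in> strip d" "\<omega> \<in> strip d" for F B \<zeta> \<omega>
  proof -
    have "cmod (\<kappa> \<zeta> \<omega> * F \<omega>) \<le> C / cosh (Re \<omega>) * B"
      unfolding norm_mult using that \<kappa> C by (intro mult_mono) auto
    then show ?thesis by (simp add: mult_ac)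
  qed
  have dk: "decaying d (\<lambda>\<omega>. \<kappa> \<zeta> \<omega> * F \<omega>)"
    if F: "F holomorphic_on strip d" "bounded (F ` strip d)" and "\<zeta> \<in> strip d" for F \<zeta>
  proof -
    obtain B where B: "0 \<le> B" "\<forall>\<zeta>\<in>strip d. cmod (F \<zeta>) \<le> B"
      using bound[OF F(2)] by blast
    show ?thesis
      by (rule decayingI[OF _ kF[OF B(2,1) that(3)]]) (intro holomorphic_intros \<kappa>2 F that)
  qed
  have Vhol: "V F holomorphic_on strip d" and Vbd: "bounded (V F ` strip d)"
    if F: "F holomorphic_on strip d" "bounded (F ` strip d)" for F
  proof -
    obtain B where B: "0 \<le> B" "\<forall>\<zeta>\<in>strip d. cmod (F \<zeta>) \<le> B"
      using bound[OF F(2)] by blast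
    have "(\<lambda>\<zeta>. I (\<lambda>\<omega>. \<kappa> \<zeta> \<omega> * F \<omega>) \<zeta>) holomorphic_on strip d"
    proof (rule volterra_diagonal_holomorphic[OF d,
        where \<kappa> = "\<lambda>\<zeta> \<omega>. \<kappa> \<zeta> \<omega> * F \<omega>" and P = "\<lambda>\<zeta>. I (\<lambda>\<omega>. \<kappa> \<zeta> \<omega> * F \<omega>)"])
      show "(\<lambda>\<zeta>. \<kappa> \<zeta> \<omega> * F \<omega>) holomorphic_on strip d" if "\<omega> \<in> strip d" for \<omega>
        by (intro holomorphic_intros \<kappa>1 that)
      show "(\<lambda>\<omega>. \<kappa> \<zeta> \<omega> * F \<omega>) holomorphic_on strip d" if "\<zeta> \<in> strip d" for \<zeta>
        by (intro holomorphic_intros \<kappa>2 F that)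
    qed (use kF[OF B(2,1)] I[OF dk[OF F]] in auto)
    then show "V F holomorphic_on strip d"
      unfolding V_def .
    have "cmod (V F \<zeta>) \<le> C * B * pi" if \<zeta>: "\<zeta> \<in> strip d" for \<zeta>
      unfolding V_def
      by (rule left_primitive_bound_pi[OF d _ I[OF dk[OF F \<zeta>]] kF[OF B(2,1) \<zeta>] \<zeta>])
         (intro holomorphic_intros \<kappa>2 F \<zeta>)
    then show "bounded (V F ` strip d)"
      unfolding bounded_iff by blast
  qed
  have Ehol: "E F holomorphic_on strip d"
    if F: "F holomorphic_on strip d" "bounded (F ` strip d)" for F
    unfolding E_def by (intro holomorphic_intros hol F Vhol)
  have Ebd: "\<exists>D. \<forall>\<zeta>\<in>strip d. cmod (E F \<zeta>) \<le> D / cosh (Re \<zeta>)"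
    if F: "F holomorphic_on strip d" "bounded (F ` strip d)" for F
  proof -
    obtain B where B: "0 \<le> B" "\<forall>\<zeta>\<in>strip d. cmod (F \<zeta>) \<le> B"
      using bound[OF F(2)] by blast
    obtain B' where B': "0 \<le> B'" "\<forall>\<zeta>\<in>strip d. cmod (V F \<zeta>) \<le> B'"
      using bound[OF Vbd[OF F]] by blast
    have "cmod (E F \<zeta>) \<le> (C + C * B + B' * C) / cosh (Re \<zeta>)" if \<zeta>: "\<zeta> \<in> strip d" for \<zeta>
    proof -
      have "cmod (E F \<zeta>) \<le> cmod (G \<zeta>) + cmod (m \<zeta>) * cmod (F \<zeta>) + cmod (V F \<zeta>) * cmod (p \<zeta>)"
        using norm_triangle_ineq[of "G \<zeta> + m \<zeta> * F \<zeta>" "V F \<zeta> * p \<zeta>"]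
          norm_triangle_ineq[of "G \<zeta>" "m \<zeta> * F \<zeta>"]
        unfolding E_def norm_mult by linarith
      also have "\<dots> \<le> C / cosh (Re \<zeta>) + C / cosh (Re \<zeta>) * B + B' * (C / cosh (Re \<zeta>))"
        using \<zeta> B B' C by (intro add_mono mult_mono G m p) auto
      finally show ?thesis by (simp add: add_divide_distrib)
    qed
    then show ?thesis by blast
  qed
  have dE: "decaying d (E F)" if F: "F holomorphic_on strip d" "bounded (F ` strip d)" for F
    using Ehol[OF F] Ebd[OF F] unfolding decaying_def by blast
  have "\<exists>U. U holomorphic_on strip d \<and> bounded (U ` strip d) \<and> (\<forall>z\<in>strip d. T U z = U z)"
  proof (rule bounded_holomorphic_fixed_point[OF open_strip, where q = "3/4" and W = "weight C"
      and ?W1.0 = "exp (2 * C * pi)"])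
    show "1 \<le> weight C z" "weight C z \<le> exp (2 * C * pi)" for z
      using C gudermann_pos[of "Re z"] gudermann_less_pi[of "Re z"] by (auto simp: weight_def)
  next
    fix F assume F: "F holomorphic_on strip d" "bounded (F ` strip d)"
    obtain D where D: "\<And>\<zeta>. \<zeta> \<in> strip d \<Longrightarrow> cmod (E F \<zeta>) \<le> D / cosh (Re \<zeta>)"
      using Ebd[OF F] by blast
    have "cmod (T F \<zeta>) \<le> cmod ua + D * pi" if \<zeta>: "\<zeta> \<in> strip d" for \<zeta>
      unfolding T_def using left_primitive_bound_pi[OF d Ehol[OF F] I[OF dE[OF F]] D \<zeta>]
      by (meson add_left_mono norm_triangle_ineq order_trans)
    then show "T F holomorphic_on strip d \<and> bounded (T F ` strip d)"
      unfolding bounded_iff T_def using left_primitive_holomorphic[OF I[OF dE[OF F]]]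
      by (auto intro!: holomorphic_intros)
  next
    fix F H M z
    assume F: "F holomorphic_on strip d" "bounded (F ` strip d)"
      and H: "H holomorphic_on strip d" "bounded (H ` strip d)"
      and diff: "\<And>z. z \<in> strip d \<Longrightarrow> cmod (F z - H z) \<le> M * weight C z"
      and z: "z \<in> strip d"
    have "0 \<le> M * weight C z" using diff[OF z] norm_ge_zero order_trans by blast
    then have M: "0 \<le> M" by (simp add: weight_def zero_le_mult_iff)
    have Vd: "cmod (V F \<zeta> - V H \<zeta>) \<le> M / 2 * weight C \<zeta>" if \<zeta>: "\<zeta> \<in> strip d" for \<zeta>
      unfolding V_def
    proof (rule left_primitive_bound_weight[OF d decaying_diff[OF dk[OF F \<zeta>] dk[OF H \<zeta>]]
            left_primitive_diff[OF I[OF dk[OF F \<zeta>]] I[OF dk[OF H \<zeta>]]] M \<zeta>])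
      fix \<omega> assume \<omega>: "\<omega> \<in> strip d"
      have "cmod (\<kappa> \<zeta> \<omega> * F \<omega> - \<kappa> \<zeta> \<omega> * H \<omega>) = cmod (\<kappa> \<zeta> \<omega>) * cmod (F \<omega> - H \<omega>)"
        by (simp add: norm_mult right_diff_distrib[symmetric])
      also have "\<dots> \<le> C / cosh (Re \<omega>) * (M * weight C \<omega>)"
        using C by (intro mult_mono \<kappa> \<zeta> \<omega> diff) auto
      finally show "cmod (\<kappa> \<zeta> \<omega> * F \<omega> - \<kappa> \<zeta> \<omega> * H \<omega>) \<le> C / cosh (Re \<omega>) * (M * weight C \<omega>)" .
    qed
    have "cmod (I (E F) z - I (E H) z) \<le> (3 / 2 * M) / 2 * weight C z"
    proof (rule left_primitive_bound_weight[OF d decaying_diff[OF dE[OF F] dE[OF H]]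
            left_primitive_diff[OF I[OF dE[OF F]] I[OF dE[OF H]]] _ z])
      fix \<zeta> assume \<zeta>: "\<zeta> \<in> strip d"
      have "E F \<zeta> - E H \<zeta> = m \<zeta> * (F \<zeta> - H \<zeta>) + p \<zeta> * (V F \<zeta> - V H \<zeta>)"
        by (simp add: E_def algebra_simps)
      then have "cmod (E F \<zeta> - E H \<zeta>) \<le> cmod (m \<zeta>) * cmod (F \<zeta> - H \<zeta>) + cmod (p \<zeta>) * cmod (V F \<zeta> - V H \<zeta>)"
        by (metis norm_mult norm_triangle_ineq)
      also have "\<dots> \<le> C / cosh (Re \<zeta>) * (M * weight C \<zeta>) + C / cosh (Re \<zeta>) * (M / 2 * weight C \<zeta>)"
        using C by (intro add_mono mult_mono m p \<zeta> diff Vd) auto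
      finally show "cmod (E F \<zeta> - E H \<zeta>) \<le> C / cosh (Re \<zeta>) * (3 / 2 * M * weight C \<zeta>)"
        by (simp add: field_simps)
    qed (use M in simp)
    then show "cmod (T F z - T H z) \<le> 3 / 4 * M * weight C z"
      by (simp add: T_def)
  qed auto
  then obtain U where U: "U holomorphic_on strip d" "bounded (U ` strip d)"
    and fix_U: "\<And>z. z \<in> strip d \<Longrightarrow> T U z = U z"
    by blast
  have "left_primitive d (E U) (\<lambda>\<zeta>. U \<zeta> - ua)"
    using left_primitive_cong[OF d I[OF dE[OF U]], of "\<lambda>\<zeta>. U \<zeta> - ua"] fix_U unfolding T_def
    by (metis add_diff_cancel_left')
  then have pU: "left_primitive d (\<lambda>\<zeta>. G \<zeta> + m \<zeta> * U \<zeta> + V U \<zeta> * p \<zeta>) (\<lambda>\<zeta>. U \<zeta> - ua)"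
    unfolding E_def .
  have "\<forall>\<zeta>\<in>strip d. left_primitive d (\<lambda>\<omega>. \<kappa> \<zeta> \<omega> * U \<omega>) (I (\<lambda>\<omega>. \<kappa> \<zeta> \<omega> * U \<omega>)) \<and> V U \<zeta> = I (\<lambda>\<omega>. \<kappa> \<zeta> \<omega> * U \<omega>) \<zeta>"
    using I[OF dk[OF U]] by (simp add: V_def)
  then show ?thesis
    using U Vhol[OF U] Vbd[OF U] pU
    by (intro exI[of _ U] exI[of _ "V U"] exI[of _ "\<lambda>\<zeta>. I (\<lambda>\<omega>. \<kappa> \<zeta> \<omega> * U \<omega>)"]) simp
qed

section \<open>The double exponential map\<close>

lemma cmod_cosh_squared: "(cmod (cosh z))\<^sup>2 = (sinh (Re z))\<^sup>2 + (cos (Im z))\<^sup>2"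
proof -
  have re: "Re (cosh z) = cosh (Re z) * cos (Im z)"
    by (simp add: cosh_field_def Re_exp field_simps)
  have im: "Im (cosh z) = sinh (Re z) * sin (Im z)"
    by (simp add: cosh_field_def sinh_field_def Im_exp field_simps)
  show ?thesis
    unfolding cmod_power2 re im power_mult_distrib cosh_square_eq sin_squared_eq by (simp add: algebra_simps)
qed

lemma cmod_cosh_le: "cmod (cosh z) \<le> cosh (Re z)"
proof -
  have "(cos (Im z))\<^sup>2 \<le> 1"
    by (simp add: abs_square_le_1)
  then have "(cmod (cosh z))\<^sup>2 \<le> (cosh (Re z))\<^sup>2"
    unfolding cmod_cosh_squared cosh_square_eq by simp
  then show ?thesis
    by (rule power2_le_imp_le) simp
qed

lemma cmod_cosh_ge: "\<bar>cos (Im z)\<bar> \<le> cmod (cosh z)" "\<bar>sinh (Re z)\<bar> \<le> cmod (cosh z)"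
  by (rule power2_le_imp_le; simp add: cmod_cosh_squared)+

text \<open>
  Write \<open>w = \<pi>/2 sinh \<zeta>\<close> and \<open>\<zeta> = x + i y\<close>. Zeros of \<open>cosh w\<close> need \<open>Re w = 0\<close> and \<open>|Im w| \<ge> \<pi>/2\<close>. With
  \<open>Re w = \<pi>/2 sinh x cos y\<close> and \<open>Im w = \<pi>/2 cosh x sin y\<close>, the restriction \<open>|y| < d < \<pi>/2\<close>
  separates the two conditions: while \<open>cosh x \<le> R\<close>, \<open>|Im w|\<close> stays below some \<open>\<theta> < \<pi>/2\<close>, and beyond
  that \<open>|Re w|\<close> is at least a multiple of \<open>cosh x\<close>.
\<close>

lemma cosh_DE_lower_bound:
  assumes d: "0 < d" "d < pi / 2"
  shows "\<exists>c>0. \<exists>k>0. \<forall>\<zeta>\<in>strip d. c * exp (k * cosh (Re \<zeta>)) \<le> cmod (cosh (of_real (pi / 2) * sinh \<zeta>))"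
proof -
  define \<sigma> where "\<sigma> = sin d"
  have \<sigma>: "0 < \<sigma>" "\<sigma> < 1"
    using d sin_gt_zero[of d] sin_monotone_2pi[of d "pi/2"] by (simp_all add: \<sigma>_def)
  have cd: "0 < cos d" using d by (intro cos_gt_zero) auto
  \<comment> \<open>Any \<open>R\<close> strictly between \<open>1\<close> and \<open>1 / sin d\<close> separates the two regimes; this is the midpoint.\<close>
  define R where "R = (1 + \<sigma>) / (2 * \<sigma>)"
  have R: "1 < R" using \<sigma> by (simp add: R_def)
  \<comment> \<open>The constant in \<open>|sinh x| \<ge> l cosh x\<close> for \<open>cosh x \<ge> R\<close>.\<close>
  define l where "l = sqrt (1 - 1 / R\<^sup>2)"
  have "1 / R\<^sup>2 < 1"
    using R by (simp add: divide_less_eq one_less_power)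
  then have l2: "l\<^sup>2 = 1 - 1 / R\<^sup>2" and l: "0 < l"
    by (simp_all add: l_def)
  define k where "k = pi / 2 * l * cos d"
  have k: "0 < k" using l cd by (simp add: k_def)
  define \<theta> where "\<theta> = pi / 2 * (R * \<sigma>)"
  have "R * \<sigma> = (1 + \<sigma>) / 2" using \<sigma> by (simp add: R_def)
  then have \<theta>: "0 < \<theta>" "\<theta> < pi / 2" using \<sigma> by (auto simp: \<theta>_def)
  have ct: "0 < cos \<theta>" using \<theta> by (intro cos_gt_zero) auto
  define c where "c = min (cos \<theta> * exp (- (k * R))) ((1 - exp (- 2 * k)) / 2)"
  have c: "0 < c" using ct k by (simp add: c_def)
  have "c * exp (k * cosh (Re \<zeta>)) \<le> cmod (cosh (of_real (pi / 2) * sinh \<zeta>))" if \<zeta>: "\<zeta> \<in> strip d" for \<zeta>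
  proof -
    define x y where "x = Re \<zeta>" and "y = Im \<zeta>"
    have y: "\<bar>y\<bar> < d" using \<zeta> by (simp add: strip_def y_def)
    define w where "w = of_real (pi / 2) * sinh \<zeta>"
    have Rew: "Re w = pi / 2 * (sinh x * cos y)" and Imw: "Im w = pi / 2 * (cosh x * sin y)"
      by (simp_all add: w_def x_def y_def sinh_field_def cosh_field_def Re_exp Im_exp field_simps)
    have siny: "\<bar>sin y\<bar> \<le> \<sigma>"
    proof -
      have "sin y \<le> sin d" "sin (-y) \<le> sin d"
        using y d by (intro sin_monotone_2pi_le; simp)+
      then show ?thesis by (simp add: \<sigma>_def abs_le_iff)
    qed
    have cosy: "cos d \<le> cos y"
      using cos_monotone_0_pi_le[of "\<bar>y\<bar>" d] y d by simp
    show ?thesis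
    proof (cases "cosh x \<le> R")
      case True
      have "\<bar>Im w\<bar> \<le> \<theta>"
      proof -
        have "cosh x * \<bar>sin y\<bar> \<le> R * \<sigma>"
          using True siny R by (intro mult_mono) auto
        then show ?thesis by (simp add: Imw \<theta>_def abs_mult)
      qed
      then have "cos \<theta> \<le> cos \<bar>Im w\<bar>"
        using \<theta> by (intro cos_monotone_0_pi_le) auto
      then have 1: "cos \<theta> \<le> cmod (cosh w)"
        using cmod_cosh_ge(1)[of w] by simp
      have "c * exp (k * cosh x) \<le> cos \<theta> * exp (- (k * R)) * exp (k * R)"
        using True k ct by (intro mult_mono) (auto simp: c_def)
      also have "\<dots> = cos \<theta>" by (simp add: exp_minus)
      finally show ?thesis using 1 by (simp add: w_def x_def)
    next
      case False
      define X where "X = cosh x"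
      have X: "R < X" "1 \<le> X" using False cosh_real_ge_1 by (auto simp: X_def)
      have "1 \<le> (X / R)\<^sup>2"
        using X R by (intro one_le_power) auto
      then have "(l * X)\<^sup>2 \<le> \<bar>sinh x\<bar>\<^sup>2"
        by (simp add: power_mult_distrib l2 sinh_square_eq X_def power_divide algebra_simps)
      then have "l * X \<le> \<bar>sinh x\<bar>"
        by (rule power2_le_imp_le) simp
      then have "l * X * cos d \<le> \<bar>sinh x\<bar> * cos y"
        using cd cosy by (intro mult_mono) auto
      then have "k * X \<le> \<bar>Re w\<bar>"
        using cd cosy by (simp add: Rew k_def abs_mult algebra_simps)
      then have "sinh (k * X) \<le> \<bar>sinh (Re w)\<bar>"
        using sinh_real_le_iff[of "k * X" "\<bar>Re w\<bar>"] by (simp only: sinh_real_abs)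
      then have 1: "sinh (k * X) \<le> cmod (cosh w)"
        using cmod_cosh_ge(2)[of w] by (rule order_trans)
      have "k * 1 \<le> k * X"
        using k X(2) by (intro mult_left_mono) auto
      then have "exp (- 2 * (k * X)) \<le> exp (- 2 * k)"
        by simp
      then have "c \<le> (1 - exp (- 2 * (k * X))) / 2"
        unfolding c_def by (intro min.coboundedI2) simp
      then have "c * exp (k * X) \<le> (1 - exp (- 2 * (k * X))) / 2 * exp (k * X)"
        by (intro mult_right_mono) auto
      also have "\<dots> = sinh (k * X)"
      proof -
        have "exp (- 2 * (k * X)) * exp (k * X) = exp (- (k * X))"
          by (simp add: exp_add[symmetric])
        then show ?thesis by (simp add: sinh_field_def left_diff_distrib)
      qed
      finally show ?thesis using 1 by (simp add: w_def x_def X_def)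
    qed
  qed
  with c k show ?thesis by blast
qed

lemma cosh_DE_nonzero:
  assumes "0 < d" "d < pi / 2" "\<zeta> \<in> strip d"
  shows "cosh (of_real (pi / 2) * sinh \<zeta>) \<noteq> 0"
proof -
  obtain c k where "0 < c" "c * exp (k * cosh (Re \<zeta>)) \<le> cmod (cosh (of_real (pi / 2) * sinh \<zeta>))"
    using cosh_DE_lower_bound[OF assms(1,2)] assms(3) by blast
  then show ?thesis
    by (metis exp_gt_zero mult_pos_pos norm_zero not_le)
qed

lemma Qs_eq:
  assumes "cosh (of_real (pi / 2) * sinh \<zeta>) \<noteq> 0"
  shows "Qs a b \<zeta> = of_real (((b - a) / 2)\<^sup>2) / (cosh (of_real (pi / 2) * sinh \<zeta>))\<^sup>2"
proof -
  define w where "w = of_real (pi / 2) * sinh \<zeta>"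
  have "Qs a b \<zeta> = of_real (((b - a) / 2)\<^sup>2) * (1 - (tanh w)\<^sup>2)"
    unfolding Qs_def psiDE_def w_def[symmetric] by (simp add: power2_eq_square field_simps)
  also have "1 - (tanh w)\<^sup>2 = 1 / (cosh w)\<^sup>2"
    using assms unfolding w_def[symmetric] by (simp add: tanh_def field_simps hyperbolic_pythagoras)
  finally show ?thesis by (simp add: w_def)
qed

text \<open>
  Polymorphic like \<open>psiDE\<close>, so that one formula gives the derivative on the strip and on the real line.
\<close>

definition psiDE_deriv :: "real \<Rightarrow> real \<Rightarrow> 'a::{real_normed_field,banach} \<Rightarrow> 'a" where
  "psiDE_deriv a b x = of_real ((b - a) * pi / 4) * cosh x / (cosh (of_real (pi / 2) * sinh x))\<^sup>2"

lemma psiDE_has_field_derivative: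
  fixes x :: "'a::{real_normed_field,banach}"
  assumes "cosh (of_real (pi / 2) * sinh x) \<noteq> 0"
  shows "(psiDE a b has_field_derivative psiDE_deriv a b x) (at x)"
proof -
  have "(psiDE a b has_field_derivative
      of_real ((b - a) / 2) * ((1 - (tanh (of_real (pi / 2) * sinh x))\<^sup>2) * (of_real (pi / 2) * cosh x))) (at x)"
    unfolding psiDE_def[abs_def] using assms by (auto intro!: derivative_eq_intros)
  moreover have "1 - (tanh (of_real (pi / 2) * sinh x))\<^sup>2 = 1 / (cosh (of_real (pi / 2) * sinh x))\<^sup>2"
    using assms by (simp add: tanh_def field_simps hyperbolic_pythagoras)
  moreover have "of_real ((b - a) * pi / 4) = (of_real ((b - a) / 2) * of_real (pi / 2) :: 'a)"
    unfolding of_real_mult[symmetric] by simp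
  ultimately show ?thesis
    by (simp only: psiDE_deriv_def mult.assoc times_divide_eq_left times_divide_eq_right mult_1_left)
qed

lemma psiDE_deriv_of_real: "psiDE_deriv a b (of_real x :: complex) = of_real (psiDE_deriv a b x)"
proof -
  have s: "sinh (of_real x :: complex) = of_real (sinh x)"
    by (simp add: sinh_field_def exp_of_real[symmetric])
  have c: "cosh (of_real y :: complex) = of_real (cosh y)" for y
    by (simp add: cosh_field_def exp_of_real[symmetric])
  have "cosh (of_real (pi / 2) * of_real (sinh x) :: complex) = of_real (cosh (pi / 2 * sinh x))"
    unfolding of_real_mult[symmetric] c ..
  then show ?thesis
    unfolding psiDE_deriv_def s c by simp
qed

lemma psiDE_deriv_pos: "a < b \<Longrightarrow> 0 < (psiDE_deriv a b x :: real)"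
  by (simp add: psiDE_deriv_def)

lemma psiDE_deriv_eq_Qs:
  assumes "a < b" "cosh (of_real (pi / 2) * sinh \<zeta>) \<noteq> 0"
  shows "psiDE_deriv a b \<zeta> = of_real (pi / (b - a)) * cosh \<zeta> * Qs a b \<zeta>"
proof -
  have "(b - a) * pi / 4 = pi / (b - a) * ((b - a) / 2)\<^sup>2"
    using assms(1) by (simp add: power2_eq_square field_simps)
  then have "of_real ((b - a) * pi / 4) = (of_real (pi / (b - a)) * of_real (((b - a) / 2)\<^sup>2) :: complex)"
    by (simp only: of_real_mult)
  moreover have swap: "A * c / X = B * c * (D / X)" if "A = B * D" for A B D c X :: complex
    using that by simp
  ultimately show ?thesis
    unfolding psiDE_deriv_def Qs_eq[OF assms(2)] by (intro swap)
qed

text \<open>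
  \<open>|Q|\<close> decays like \<open>exp (-2k cosh x)\<close>, and \<open>exp (-t) \<le> 2/t\<^sup>2\<close>. Two powers of \<open>cosh x\<close> are kept: one
  absorbs the factor \<open>cosh \<zeta>\<close> in \<open>\<psi>'\<close>, the other is the integrable majorant.
\<close>

lemma Qs_powr_bound:
  assumes ab: "a < b" and \<alpha>: "0 < \<alpha>" and d: "0 < d" "d < pi / 2"
  shows "\<exists>C>0. \<forall>\<zeta>\<in>strip d. cmod (Qs a b \<zeta>) powr \<alpha> \<le> C / (cosh (Re \<zeta>))\<^sup>2"
proof -
  obtain c k where c: "0 < c" and k: "0 < k"
    and lower: "\<And>\<zeta>. \<zeta> \<in> strip d \<Longrightarrow> c * exp (k * cosh (Re \<zeta>)) \<le> cmod (cosh (of_real (pi / 2) * sinh \<zeta>))"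
    using cosh_DE_lower_bound[OF d] by blast
  define A where "A = ((b - a) / 2 / c)\<^sup>2"
  have A: "0 < A" using ab c by (simp add: A_def)
  define h where "h = 2 * k * \<alpha>"
  have h: "0 < h" using k \<alpha> by (simp add: h_def)
  have "cmod (Qs a b \<zeta>) powr \<alpha> \<le> (A powr \<alpha> * 2 / h\<^sup>2) / (cosh (Re \<zeta>))\<^sup>2" if \<zeta>: "\<zeta> \<in> strip d" for \<zeta>
  proof -
    define X where "X = cosh (Re \<zeta>)"
    have X: "1 \<le> X" by (simp add: X_def cosh_real_ge_1)
    define v where "v = cmod (cosh (of_real (pi / 2) * sinh \<zeta>))"
    have v: "c * exp (k * X) \<le> v" using lower[OF \<zeta>] by (simp add: v_def X_def)
    have v0: "0 < v" using v c by (meson exp_gt_zero less_le_trans mult_pos_pos)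
    have "cmod (Qs a b \<zeta>) = ((b - a) / 2)\<^sup>2 / v\<^sup>2"
      using Qs_eq[OF cosh_DE_nonzero[OF d \<zeta>], of a b]
      by (simp add: norm_divide norm_power v_def del: of_real_power of_real_divide of_real_diff)
    also have "\<dots> \<le> ((b - a) / 2)\<^sup>2 / (c * exp (k * X))\<^sup>2"
      using v v0 c by (intro divide_left_mono power_mono) auto
    also have "\<dots> = A * exp (- (2 * k * X))"
      using c by (simp add: A_def power_mult_distrib power_divide exp_minus exp_double[symmetric] field_simps)
    finally have "cmod (Qs a b \<zeta>) powr \<alpha> \<le> (A * exp (- (2 * k * X))) powr \<alpha>"
      using \<alpha> by (intro powr_mono2) auto
    also have "\<dots> = A powr \<alpha> * exp (- (h * X))"
      using A by (simp add: powr_mult exp_powr_real h_def mult_ac)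
    also have "\<dots> \<le> A powr \<alpha> * (2 / (h * X)\<^sup>2)"
    proof -
      have hX: "0 < h * X" using h X by simp
      then have "(h * X)\<^sup>2 / 2 \<le> exp (h * X)"
        using exp_lower_Taylor_quadratic[of "h * X"] by linarith
      then have "1 / exp (h * X) \<le> 1 / ((h * X)\<^sup>2 / 2)"
        using hX by (intro divide_left_mono mult_pos_pos) auto
      then have "exp (- (h * X)) \<le> 2 / (h * X)\<^sup>2"
        by (simp add: exp_minus inverse_eq_divide)
      then show ?thesis by (intro mult_left_mono) auto
    qed
    finally show ?thesis
      by (simp add: X_def power_mult_distrib)
  qed
  moreover have "0 < A powr \<alpha> * 2 / h\<^sup>2" using A h by simp
  ultimately show ?thesis by blast
qed

lemma Qs_nonzero:
  assumes "a < b" "0 < d" "d < pi / 2" "\<zeta> \<in> strip d"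
  shows "Qs a b \<zeta> \<noteq> 0"
  using assms cosh_DE_nonzero[OF assms(2-4)] by (simp add: Qs_eq)

lemma Qs_holomorphic:
  assumes "0 < d" "d < pi / 2"
  shows "Qs a b holomorphic_on strip d"
proof -
  have "(\<lambda>\<zeta>. of_real (((b - a) / 2)\<^sup>2) / (cosh (of_real (pi / 2) * sinh \<zeta>))\<^sup>2) holomorphic_on strip d"
    using cosh_DE_nonzero[OF assms]
    by (auto intro!: holomorphic_intros simp: sinh_field_def cosh_field_def)
  then show ?thesis
    using Qs_eq[OF cosh_DE_nonzero[OF assms]] by (simp cong: holomorphic_cong)
qed

lemma cosh_real_DE_nonzero: "cosh (of_real (pi / 2) * sinh x) \<noteq> (0::real)"
  by simp

lemma psiDE_real_in_interval:
  assumes "a < b" shows "psiDE a b (x::real) \<in> {a<..<b}"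
proof -
  have "psiDE a b x - a = (b - a) / 2 * (1 + tanh (pi / 2 * sinh x))"
    "b - psiDE a b x = (b - a) / 2 * (1 - tanh (pi / 2 * sinh x))"
    by (simp_all add: psiDE_def field_simps)
  moreover have "0 < 1 + tanh (pi / 2 * sinh x)" "0 < 1 - tanh (pi / 2 * sinh x)"
    using tanh_real_lt_1[of "pi / 2 * sinh x"] tanh_real_gt_neg1[of "pi / 2 * sinh x"] by linarith+
  ultimately have "0 < psiDE a b x - a" "0 < b - psiDE a b x"
    using assms by (simp_all only: mult_pos_pos zero_less_divide_iff) simp_all
  then show ?thesis by simp
qed

lemma psiDE_real_less_iff: "a < b \<Longrightarrow> psiDE a b (x::real) < psiDE a b y \<longleftrightarrow> x < y"
  by (simp add: psiDE_def divide_less_cancel)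

lemma psiDE_real_inj: "a < b \<Longrightarrow> inj (psiDE a b :: real \<Rightarrow> real)"
  by (metis injI less_irrefl linorder_less_linear psiDE_real_less_iff)

abbreviation psiDE_inv :: "real \<Rightarrow> real \<Rightarrow> real \<Rightarrow> real" where
  "psiDE_inv a b \<equiv> inv (psiDE a b)"

lemma psiDE_psiDE_inv:
  assumes "t \<in> {a<..<b}" shows "psiDE a b (psiDE_inv a b t) = t"
proof -
  define z where "z = (2 * t - a - b) / (b - a)"
  have z: "\<bar>z\<bar> < 1" using assms by (auto simp: z_def abs_less_iff field_simps)
  define r where "r = sqrt ((1 + z) / (1 - z))"
  have r: "0 < r" "r\<^sup>2 = (1 + z) / (1 - z)" using z by (auto simp: r_def abs_less_iff)
  have "tanh (ln r) = z"
    using z by (simp add: tanh_ln_real[OF r(1)] r(2) field_simps)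
  then have "psiDE a b (arsinh (2 / pi * ln r)) = (b - a) / 2 * z + (b + a) / 2"
    by (simp add: psiDE_def)
  also have "\<dots> = t"
    using assms by (simp add: z_def field_simps)
  finally show ?thesis by (metis f_inv_into_f rangeI)
qed

lemma psiDE_inv_has_derivative:
  assumes "t \<in> {a<..<b}"
  shows "(psiDE_inv a b has_real_derivative inverse (psiDE_deriv a b (psiDE_inv a b t))) (at t)"
proof -
  have ab: "a < b" using assms by simp
  have "(psiDE_inv a b has_real_derivative inverse (psiDE_deriv a b (psiDE_inv a b t))) (at (psiDE a b (psiDE_inv a b t)))"
  proof (rule has_field_derivative_inverse_strong[where S = UNIV and f = "psiDE a b" and x = "psiDE_inv a b t"])
    show "(psiDE a b has_real_derivative psiDE_deriv a b (psiDE_inv a b t)) (at (psiDE_inv a b t))"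
      by (intro psiDE_has_field_derivative cosh_real_DE_nonzero)
    show "continuous_on UNIV (psiDE a b :: real \<Rightarrow> real)"
      using psiDE_has_field_derivative[OF cosh_real_DE_nonzero]
      by (meson DERIV_isCont continuous_at_imp_continuous_on)
    show "psiDE_inv a b (psiDE a b z) = z" for z
      using psiDE_real_inj[OF ab] by simp
  qed (use psiDE_deriv_pos[OF ab, of "psiDE_inv a b t"] in auto)
  then show ?thesis by (simp add: psiDE_psiDE_inv[OF assms])
qed

lemma psiDE_inv_at_bot:
  assumes "a < b" shows "filterlim (psiDE_inv a b) at_bot (at_right a)"
  unfolding filterlim_at_bot
proof
  fix Z :: real
  have Z: "a < psiDE a b Z" "psiDE a b Z < b" using psiDE_real_in_interval[OF assms, of Z] by auto
  have "psiDE_inv a b t \<le> Z" if "a < t" "t < psiDE a b Z" for t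
    using that Z psiDE_psiDE_inv[of t a b] psiDE_real_less_iff[OF assms, of "psiDE_inv a b t" Z] by simp
  then show "\<forall>\<^sub>F t in at_right a. psiDE_inv a b t \<le> Z"
    unfolding eventually_at_right_field using Z(1) by (intro exI[of _ "psiDE a b Z"]) simp
qed

text \<open>
  The substitution \<open>s = \<psi>(x)\<close>, carried out on the primitive: \<open>H \<circ> \<psi>\<^sup>-\<^sup>1\<close> extends continuously to \<open>a\<close>
  by \<open>L\<close> and has the stated derivative inside, so the fundamental theorem of calculus gives
  integrability up to the singular end point as well as the value.
\<close>

lemma DE_fundamental_theorem:
  fixes H :: "real \<Rightarrow> 'a::banach"
  assumes der: "\<And>x. (H has_vector_derivative h x) (at x)" and lim: "(H \<longlongrightarrow> L) at_bot"
    and t: "t \<in> {a<..<b}"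
  shows "((\<lambda>s. inverse (psiDE_deriv a b (psiDE_inv a b s)) *\<^sub>R h (psiDE_inv a b s)) has_integral (H (psiDE_inv a b t) - L)) {a<..<t}"
proof -
  have ab: "a < b" using t by simp
  define f where "f s = (if s \<le> a then L else H (psiDE_inv a b s))" for s
  have fd: "(f has_vector_derivative inverse (psiDE_deriv a b (psiDE_inv a b s)) *\<^sub>R h (psiDE_inv a b s)) (at s)"
    if "s \<in> {a<..<b}" for s
  proof (rule has_vector_derivative_transform_within_open[where S = "{a<..<b}"])
    have "(psiDE_inv a b has_vector_derivative inverse (psiDE_deriv a b (psiDE_inv a b s))) (at s)"
      using psiDE_inv_has_derivative[OF that] has_real_derivative_iff_has_vector_derivative by blast
    from vector_diff_chain_at[OF this der]
    show "((\<lambda>s. H (psiDE_inv a b s)) has_vector_derivative inverse (psiDE_deriv a b (psiDE_inv a b s)) *\<^sub>R h (psiDE_inv a b s)) (at s)"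
      by (simp add: o_def)
  qed (use that in \<open>auto simp: f_def\<close>)
  have "continuous_on {a..t} f"
    unfolding continuous_on_eq_continuous_within
  proof
    fix s assume s: "s \<in> {a..t}"
    show "continuous (at s within {a..t}) f"
    proof (cases "s = a")
      case True
      have "((\<lambda>s. H (psiDE_inv a b s)) \<longlongrightarrow> L) (at_right a)"
        by (rule filterlim_compose[OF lim psiDE_inv_at_bot[OF ab]])
      then have "(f \<longlongrightarrow> L) (at_right a)"
        by (rule Lim_transform_eventually) (auto simp: f_def eventually_at_right_less intro: eventually_mono[OF eventually_at_right_less[of a]])
      then have "(f \<longlongrightarrow> f a) (at a within {a..t})"
        using t by (simp add: f_def at_within_Icc_at_right)
      then show ?thesis using True by (simp add: continuous_within)
    next
      case False
      then have "s \<in> {a<..<b}" using s t by auto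
      then show ?thesis
        using fd has_vector_derivative_continuous continuous_at_imp_continuous_within by blast
    qed
  qed
  then have "((\<lambda>s. inverse (psiDE_deriv a b (psiDE_inv a b s)) *\<^sub>R h (psiDE_inv a b s)) has_integral (f t - f a)) {a..t}"
    using t fd by (intro fundamental_theorem_of_calculus_interior) auto
  then show ?thesis
    using t by (simp add: f_def has_integral_Icc_iff_Ioo)
qed

section \<open>The initial value problem on the real interval\<close>

lemma weight_ge_1: "0 \<le> C \<Longrightarrow> 1 \<le> weight C \<zeta>"
  using gudermann_pos[of "Re \<zeta>"] by (simp add: weight_def less_imp_le)

text \<open>
  Left primitives on the strip restrict to integrals from \<open>a\<close> in the original variable.
\<close>

lemma left_primitive_DE_has_integral:
  assumes d: "0 < d" and G: "left_primitive d (\<lambda>\<omega>. f \<omega> * psiDE_deriv a b \<omega>) G" and t: "t \<in> {a<..<b}"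
  shows "((\<lambda>s. f (param a b s)) has_integral G (param a b t)) {a<..<t}"
proof -
  have ab: "a < b" using t by simp
  have "((\<lambda>x. G (of_real x)) has_vector_derivative f (of_real x) * psiDE_deriv a b (of_real x)) (at x)" for x
    using G d unfolding left_primitive_def by (intro has_vector_derivative_real_field) simp
  from DE_fundamental_theorem[OF this _ t] G
  have "((\<lambda>s. inverse (psiDE_deriv a b (psiDE_inv a b s)) *\<^sub>R (f (param a b s) * psiDE_deriv a b (param a b s)))
          has_integral (G (param a b t) - 0)) {a<..<t}"
    unfolding left_primitive_def param_def by blast
  moreover have "inverse (psiDE_deriv a b (psiDE_inv a b s)) *\<^sub>R (f (param a b s) * psiDE_deriv a b (param a b s)) = f (param a b s)" for s
  proof -
    have "psiDE_deriv a b (psiDE_inv a b s) \<noteq> 0" using psiDE_deriv_pos[OF ab] less_irrefl by metis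
    then show ?thesis
      by (simp add: param_def psiDE_deriv_of_real scaleR_conv_of_real)
  qed
  ultimately show ?thesis by simp
qed

lemma weight_has_integral:
  assumes t: "t \<in> {a<..<b}"
  shows "((\<lambda>s. inverse (psiDE_deriv a b (psiDE_inv a b s)) * (C / cosh (psiDE_inv a b s)) * (M * weight C (param a b s)))
    has_integral (M / 2 * weight C (param a b t) - M / 2)) {a<..<t}"
proof -
  have "((\<lambda>x. M / 2 * exp (2 * C * gudermann x)) has_real_derivative
           C / cosh x * (M * exp (2 * C * gudermann x))) (at x)" for x
    by (rule derivative_eq_intros gudermann_has_derivative refl | simp)+
  then have der: "((\<lambda>x. M / 2 * exp (2 * C * gudermann x)) has_vector_derivative
           C / cosh x * (M * exp (2 * C * gudermann x))) (at x)" for x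
    using has_real_derivative_iff_has_vector_derivative by blast
  have "((\<lambda>x. M / 2 * exp (2 * C * gudermann x)) \<longlongrightarrow> M / 2 * exp (2 * C * 0)) at_bot"
    by (intro tendsto_intros gudermann_tendsto_0)
  from DE_fundamental_theorem[OF der this t] show ?thesis
    by (simp add: weight_def param_def mult_ac)
qed

text \<open>
  A priori \<open>u\<close> is an arbitrary function; continuity comes from its being an indefinite integral.
  It gives the boundedness that starts the uniqueness argument and the measurability of \<open>k u\<close>.
\<close>

lemma solves_ivp_continuous:
  assumes ab: "a < b" and u: "solves_ivp a b ua g \<mu> k u"
  shows "continuous_on {a..b} u"
proof -
  let ?f = "\<lambda>s. g (param a b s) + \<mu> (param a b s) * u s
              + integral {a..s} (\<lambda>r. k (param a b s) (param a b r) * u r)"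
  have f: "(?f has_integral (u t - ua)) {a..t}" if "t \<in> {a..b}" for t
    using u that unfolding solves_ivp_def by blast
  have "?f integrable_on {a..b}"
    using f[of b] ab by (auto simp: integrable_on_def)
  from indefinite_integral_continuous_1[OF this]
  have "continuous_on {a..b} (\<lambda>t. ua + integral {a..t} ?f)"
    by (intro continuous_intros)
  then show ?thesis
  proof (rule continuous_on_eq)
    show "ua + integral {a..t} ?f = u t" if "t \<in> {a..b}" for t
      using integral_unique[OF f[OF that]] by simp
  qed
qed

text \<open>
  The difference \<open>u - U\<close> satisfies the homogeneous Volterra equation. Repeating the contraction estimate
  on \<open>(a,b)\<close> improves any bound \<open>M weight\<close> for it to \<open>3/4 M weight\<close>, so it vanishes. The inner integrals can
  only be subtracted once \<open>k u\<close> is known to be integrable up to the singular end point \<open>a\<close>.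
\<close>

lemma solves_ivp_unique:
  fixes a b d C :: real and ua :: complex
    and g \<mu> U V :: "complex \<Rightarrow> complex" and k P :: "complex \<Rightarrow> complex \<Rightarrow> complex"
    and u :: "real \<Rightarrow> complex"
  assumes ab: "a < b" and d: "0 < d" and C: "0 < C"
    and U: "U holomorphic_on strip d" "bounded (U ` strip d)"
    and P: "\<And>\<zeta>. \<zeta> \<in> strip d \<Longrightarrow> left_primitive d (\<lambda>\<omega>. k \<zeta> \<omega> * U \<omega> * psiDE_deriv a b \<omega>) (P \<zeta>)"
    and V: "\<And>\<zeta>. \<zeta> \<in> strip d \<Longrightarrow> V \<zeta> = P \<zeta> \<zeta>"
    and pU: "left_primitive d (\<lambda>\<zeta>. (g \<zeta> + \<mu> \<zeta> * U \<zeta> + V \<zeta>) * psiDE_deriv a b \<zeta>) (\<lambda>\<zeta>. U \<zeta> - ua)"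
    and k_hol: "\<And>\<zeta>. \<zeta> \<in> strip d \<Longrightarrow> k \<zeta> holomorphic_on strip d"
    and psi_bd: "\<And>\<zeta>. \<zeta> \<in> strip d \<Longrightarrow> cmod (psiDE_deriv a b \<zeta>) \<le> C / cosh (Re \<zeta>)"
    and \<mu>_bd: "\<And>\<zeta>. \<zeta> \<in> strip d \<Longrightarrow> cmod (\<mu> \<zeta> * psiDE_deriv a b \<zeta>) \<le> C / cosh (Re \<zeta>)"
    and k_bd: "\<And>\<zeta> \<omega>. \<zeta> \<in> strip d \<Longrightarrow> \<omega> \<in> strip d \<Longrightarrow> cmod (k \<zeta> \<omega> * psiDE_deriv a b \<omega>) \<le> C / cosh (Re \<omega>)"
    and u: "solves_ivp a b ua g \<mu> k u"
    and t: "t \<in> {a<..<b}"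
  shows "U (param a b t) = u t"
proof -
  \<comment> \<open>\<open>N\<close> is the majorant \<open>C / cosh\<close> in the variable \<open>s\<close>; it dominates \<open>1\<close>, \<open>|\<mu>|\<close> and \<open>|k(\<zeta>, \<cdot>)|\<close>.\<close>
  define N where "N s = inverse (psiDE_deriv a b (psiDE_inv a b s)) * (C / cosh (psiDE_inv a b s))" for s
  have inS: "param a b s \<in> strip d" for s
    using d by (simp add: param_def)
  have N_bd: "cmod z \<le> N s" if "cmod (z * psiDE_deriv a b (param a b s)) \<le> C / cosh (Re (param a b s))" for z s
    using that psiDE_deriv_pos[OF ab, of "psiDE_inv a b s"]
    by (simp add: N_def param_def psiDE_deriv_of_real norm_mult field_simps)
  have N: "1 \<le> N s" "cmod (\<mu> (param a b s)) \<le> N s" "cmod (k \<zeta> (param a b s)) \<le> N s"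
    if "\<zeta> \<in> strip d" for s \<zeta>
    using N_bd[of 1 s] N_bd[OF \<mu>_bd[OF inS]] N_bd[OF k_bd[OF that inS]] psi_bd[OF inS, of s] by auto
  have majorant: "((\<lambda>s. N s * (M * weight C (param a b s))) has_integral
      (M / 2 * weight C (param a b t) - M / 2)) {a<..<t}" if "t \<in> {a<..<b}" for M t
    using weight_has_integral[OF that] unfolding N_def .
  have cont_u: "continuous_on {a..b} u"
    by (rule solves_ivp_continuous[OF ab u])
  then have "bounded (u ` {a..b})"
    by (intro compact_imp_bounded compact_continuous_image) auto
  then obtain Bu where Bu: "\<And>s. s \<in> {a..b} \<Longrightarrow> cmod (u s) \<le> Bu"
    unfolding bounded_iff by blast
  obtain BU where BU: "\<And>\<zeta>. \<zeta> \<in> strip d \<Longrightarrow> cmod (U \<zeta>) \<le> BU"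
    using U(2) unfolding bounded_iff by blast
  have B0: "0 \<le> Bu" "0 \<le> BU"
    using Bu[of a] BU[OF inS[of a]] ab order_trans[OF norm_ge_zero] by auto
  have volterra_U: "((\<lambda>r. k (param a b s) (param a b r) * U (param a b r)) has_integral V (param a b s)) {a<..<s}"
    if "s \<in> {a<..<b}" for s
    using left_primitive_DE_has_integral[OF d P[OF inS] that] V[OF inS] by simp
  have volterra_u: "(\<lambda>r. k (param a b s) (param a b r) * u r) integrable_on {a<..<s}"
    if s: "s \<in> {a<..<b}" for s
  proof (rule measurable_bounded_by_integrable_imp_integrable)
    have "continuous_on {a<..<s} (psiDE_inv a b)"
      using s by (intro continuous_at_imp_continuous_on ballI DERIV_isCont[OF psiDE_inv_has_derivative]) auto
    then have "continuous_on {a<..<s} (param a b)"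
      unfolding param_def[abs_def] by (intro continuous_intros)
    then have "continuous_on {a<..<s} (\<lambda>r. k (param a b s) (param a b r))"
      using inS by (intro continuous_on_compose2[OF holomorphic_on_imp_continuous_on[OF k_hol[OF inS[of s]]]]) auto
    then have "continuous_on {a<..<s} (\<lambda>r. k (param a b s) (param a b r) * u r)"
      using s by (intro continuous_intros continuous_on_subset[OF cont_u]) auto
    then show "(\<lambda>r. k (param a b s) (param a b r) * u r) \<in> borel_measurable (lebesgue_on {a<..<s})"
      by (intro continuous_imp_measurable_on_sets_lebesgue) auto
    show "(\<lambda>r. N r * (Bu * weight C (param a b r))) integrable_on {a<..<s}"
      using majorant[OF s] by blast
    show "cmod (k (param a b s) (param a b r) * u r) \<le> N r * (Bu * weight C (param a b r))" if "r \<in> {a<..<s}" for r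
    proof -
      have "cmod (u r) \<le> Bu * 1" using Bu[of r] that s by simp
      also have "\<dots> \<le> Bu * weight C (param a b r)"
        using B0 C weight_ge_1 by (intro mult_left_mono) auto
      finally show ?thesis
        unfolding norm_mult using N[OF inS] by (intro mult_mono) (auto intro: order_trans[OF norm_ge_zero])
    qed
  qed auto
  have decay: "cmod (u t - U (param a b t)) \<le> (3 / 4) ^ n * (Bu + BU) * weight C (param a b t)"
    if "t \<in> {a<..<b}" for n t
    using that
  proof (induction n arbitrary: t)
    case 0
    have "cmod (u t - U (param a b t)) \<le> (Bu + BU) * 1"
      using norm_triangle_ineq4[of "u t" "U (param a b t)"] Bu[of t] BU[OF inS[of t]] 0 by simp
    also have "\<dots> \<le> (Bu + BU) * weight C (param a b t)"
      using B0 C weight_ge_1 by (intro mult_left_mono) auto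
    finally show ?case by simp
  next
    case (Suc n)
    define M where "M = (3 / 4) ^ n * (Bu + BU)"
    have M: "0 \<le> M" using B0 by (simp add: M_def)
    have IH: "cmod (u s - U (param a b s)) \<le> M * weight C (param a b s)" if "s \<in> {a<..<b}" for s
      using Suc.IH[OF that] by (simp add: M_def)
    define W where "W s = integral {a..s} (\<lambda>r. k (param a b s) (param a b r) * u r)" for s
    have Wd: "cmod (W s - V (param a b s)) \<le> M / 2 * weight C (param a b s)" if s: "s \<in> {a<..<b}" for s
    proof -
      have "W s = integral {a<..<s} (\<lambda>r. k (param a b s) (param a b r) * u r)"
        by (simp add: W_def integral_open_interval_real)
      then have "((\<lambda>r. k (param a b s) (param a b r) * u r) has_integral W s) {a<..<s}"
        using volterra_u[OF s] integrable_integral by simp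
      from has_integral_diff[OF this volterra_U[OF s]]
      have diff: "((\<lambda>r. k (param a b s) (param a b r) * (u r - U (param a b r)))
          has_integral (W s - V (param a b s))) {a<..<s}"
        by (simp add: right_diff_distrib)
      have "cmod (W s - V (param a b s)) \<le> M / 2 * weight C (param a b s) - M / 2"
        unfolding integral_unique[OF diff, symmetric] integral_unique[OF majorant[OF s, of M], symmetric]
      proof (rule integral_norm_bound_integral)
        fix r assume "r \<in> {a<..<s}"
        then show "cmod (k (param a b s) (param a b r) * (u r - U (param a b r))) \<le> N r * (M * weight C (param a b r))"
          unfolding norm_mult using N[OF inS] s
          by (intro mult_mono IH) (auto intro: order_trans[OF norm_ge_zero])
      qed (use diff majorant[OF s, of M] in auto)
      then show ?thesis using M by simp
    qed
    have "((\<lambda>s. g (param a b s) + \<mu> (param a b s) * u s + W s) has_integral (u t - ua)) {a<..<t}"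
      using u Suc.prems unfolding solves_ivp_def W_def has_integral_Icc_iff_Ioo[symmetric] by auto
    from has_integral_diff[OF this left_primitive_DE_has_integral[OF d pU Suc.prems]]
    have diff: "((\<lambda>s. \<mu> (param a b s) * (u s - U (param a b s)) + (W s - V (param a b s)))
        has_integral (u t - U (param a b t))) {a<..<t}"
      by (simp add: algebra_simps)
    have "cmod (u t - U (param a b t)) \<le> (3 / 2 * M) / 2 * weight C (param a b t) - (3 / 2 * M) / 2"
      unfolding integral_unique[OF diff, symmetric] integral_unique[OF majorant[OF Suc.prems, of "3 / 2 * M"], symmetric]
    proof (rule integral_norm_bound_integral)
      fix s assume "s \<in> {a<..<t}"
      then have s: "s \<in> {a<..<b}" using Suc.prems by auto
      have "cmod (\<mu> (param a b s) * (u s - U (param a b s)) + (W s - V (param a b s)))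
          \<le> cmod (\<mu> (param a b s)) * cmod (u s - U (param a b s)) + 1 * cmod (W s - V (param a b s))"
        using norm_triangle_ineq[of "\<mu> (param a b s) * (u s - U (param a b s))" "W s - V (param a b s)"]
        by (simp add: norm_mult)
      also have "\<dots> \<le> N s * (M * weight C (param a b s)) + N s * (M / 2 * weight C (param a b s))"
        using N[OF inS, of s] by (intro add_mono mult_mono IH Wd s) (auto intro: order_trans[OF norm_ge_zero])
      finally show "cmod (\<mu> (param a b s) * (u s - U (param a b s)) + (W s - V (param a b s)))
          \<le> N s * (3 / 2 * M * weight C (param a b s))"
        by (simp add: algebra_simps)
    qed (use diff majorant[OF Suc.prems, of "3 / 2 * M"] in auto)
    then show ?case using M by (simp add: M_def)
  qed
  have "(\<lambda>n. (3 / 4 :: real) ^ n * (Bu + BU) * weight C (param a b t)) \<longlonglongrightarrow> 0"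
    by (intro tendsto_mult_left_zero LIMSEQ_realpow_zero) auto
  from LIMSEQ_le_const[OF this] have "cmod (u t - U (param a b t)) \<le> 0"
    using decay[OF t] by blast
  then show ?thesis by simp
qed

section \<open>The function classes and the regularity theorem\<close>

lemma L_space_mult_bounded:
  assumes f: "f \<in> L_space a b d \<alpha>" and h: "h holomorphic_on strip d" "bounded (h ` strip d)"
  shows "(\<lambda>\<zeta>. h \<zeta> * f \<zeta>) \<in> L_space a b d \<alpha>"
proof -
  obtain K where K: "\<And>\<zeta>. \<zeta> \<in> strip d \<Longrightarrow> cmod (f \<zeta>) \<le> K * cmod (Qs a b \<zeta>) powr \<alpha>"
    and hol: "f holomorphic_on strip d"
    using f unfolding L_space_def by blast
  obtain B where B: "\<And>\<zeta>. \<zeta> \<in> strip d \<Longrightarrow> cmod (h \<zeta>) \<le> B"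
    using h(2) unfolding bounded_iff by blast
  have "cmod (h \<zeta> * f \<zeta>) \<le> B * K * cmod (Qs a b \<zeta>) powr \<alpha>" if "\<zeta> \<in> strip d" for \<zeta>
    unfolding norm_mult mult.assoc using K[OF that] B[OF that]
    by (intro mult_mono) (auto intro: order_trans[OF norm_ge_zero])
  moreover have "(\<lambda>\<zeta>. h \<zeta> * f \<zeta>) holomorphic_on strip d"
    by (intro holomorphic_intros h hol)
  ultimately show ?thesis
    unfolding L_space_def by blast
qed

text \<open>
  \<open>|Q| = |Q|\<^bsup>1-\<alpha>\<^esup> |Q|\<^sup>\<alpha>\<close>, where the first factor is bounded because \<open>\<alpha> \<le> 1\<close>.
\<close>

lemma Qs_in_L_space:
  assumes ab: "a < b" and d: "0 < d" "d < pi / 2" and \<alpha>: "\<alpha> \<le> 1"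
  shows "Qs a b \<in> L_space a b d \<alpha>"
proof -
  obtain C where C: "0 < C" "\<And>\<zeta>. \<zeta> \<in> strip d \<Longrightarrow> cmod (Qs a b \<zeta>) powr 1 \<le> C / (cosh (Re \<zeta>))\<^sup>2"
    using Qs_powr_bound[OF ab, of 1 d] d by auto
  have "cmod (Qs a b \<zeta>) \<le> C powr (1 - \<alpha>) * cmod (Qs a b \<zeta>) powr \<alpha>" if \<zeta>: "\<zeta> \<in> strip d" for \<zeta>
  proof -
    have Q0: "0 < cmod (Qs a b \<zeta>)" using Qs_nonzero[OF ab d \<zeta>] by simp
    have "cmod (Qs a b \<zeta>) \<le> C / (cosh (Re \<zeta>))\<^sup>2" using C(2)[OF \<zeta>] by simp
    also have "\<dots> \<le> C / 1"
      using C(1) by (intro divide_left_mono one_le_power cosh_real_ge_1) auto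
    finally have "cmod (Qs a b \<zeta>) powr (1 - \<alpha>) \<le> C powr (1 - \<alpha>)"
      using \<alpha> by (intro powr_mono2) auto
    then have "cmod (Qs a b \<zeta>) powr (1 - \<alpha>) * cmod (Qs a b \<zeta>) powr \<alpha> \<le> C powr (1 - \<alpha>) * cmod (Qs a b \<zeta>) powr \<alpha>"
      by (rule mult_right_mono) simp
    then show ?thesis
      using Q0 by (simp add: powr_add[symmetric])
  qed
  then show ?thesis
    using Qs_holomorphic[OF d] unfolding L_space_def by blast
qed

lemma L_space_pointwise_limit:
  assumes ab: "a < b" and d: "0 < d" "d < pi / 2" and \<alpha>: "0 < \<alpha>"
    and f: "\<And>n::nat. f n holomorphic_on strip d"
    and K: "\<And>n \<zeta>. \<zeta> \<in> strip d \<Longrightarrow> cmod (f n \<zeta>) \<le> K * cmod (Qs a b \<zeta>) powr \<alpha>"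
    and lim: "\<And>\<zeta>. \<zeta> \<in> strip d \<Longrightarrow> (\<lambda>n. f n \<zeta>) \<longlonglongrightarrow> h \<zeta>"
  shows "h \<in> L_space a b d \<alpha>"
proof -
  obtain C where C: "0 < C" "\<And>\<zeta>. \<zeta> \<in> strip d \<Longrightarrow> cmod (Qs a b \<zeta>) powr \<alpha> \<le> C / (cosh (Re \<zeta>))\<^sup>2"
    using Qs_powr_bound[OF ab \<alpha> d] by blast
  have "cmod (f n \<zeta>) \<le> \<bar>K\<bar> * C" if \<zeta>: "\<zeta> \<in> strip d" for n \<zeta>
  proof -
    have "cmod (Qs a b \<zeta>) powr \<alpha> \<le> C / 1"
      using C(1) by (intro order_trans[OF C(2)[OF \<zeta>]] divide_left_mono one_le_power cosh_real_ge_1) auto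
    then have "\<bar>K\<bar> * cmod (Qs a b \<zeta>) powr \<alpha> \<le> \<bar>K\<bar> * C"
      by (intro mult_left_mono) auto
    moreover have "K * cmod (Qs a b \<zeta>) powr \<alpha> \<le> \<bar>K\<bar> * cmod (Qs a b \<zeta>) powr \<alpha>"
      by (intro mult_right_mono) auto
    ultimately show ?thesis using K[OF \<zeta>, of n] by linarith
  qed
  then have "h holomorphic_on strip d"
    using holomorphic_on_pointwise_limit[OF open_strip f _ lim] by blast
  moreover have "cmod (h \<zeta>) \<le> K * cmod (Qs a b \<zeta>) powr \<alpha>" if "\<zeta> \<in> strip d" for \<zeta>
    by (rule LIMSEQ_le_const2[OF tendsto_norm[OF lim[OF that]]]) (use K that in auto)
  ultimately show ?thesis
    unfolding L_space_def by blast
qed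

text \<open>
  Stated for a value \<open>z\<close> instead of a function, so that \<open>D\<close> depends on \<open>K\<close> only; for the kernel this
  makes the bound uniform in its first argument.
\<close>

lemma psiDE_deriv_decay:
  assumes ab: "a < b" and d: "0 < d" "d < pi / 2" and \<alpha>: "0 < \<alpha>"
  shows "\<exists>D. \<forall>z. \<forall>\<zeta>\<in>strip d. cmod (z * Qs a b \<zeta>) \<le> K * cmod (Qs a b \<zeta>) powr \<alpha> \<longrightarrow>
    cmod (z * psiDE_deriv a b \<zeta>) \<le> D / cosh (Re \<zeta>)"
proof -
  obtain C where C: "0 < C" "\<And>\<zeta>. \<zeta> \<in> strip d \<Longrightarrow> cmod (Qs a b \<zeta>) powr \<alpha> \<le> C / (cosh (Re \<zeta>))\<^sup>2"
    using Qs_powr_bound[OF ab \<alpha> d] by blast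
  have "cmod (z * psiDE_deriv a b \<zeta>) \<le> (pi / (b - a) * (\<bar>K\<bar> * C)) / cosh (Re \<zeta>)"
    if \<zeta>: "\<zeta> \<in> strip d" and z: "cmod (z * Qs a b \<zeta>) \<le> K * cmod (Qs a b \<zeta>) powr \<alpha>" for z \<zeta>
  proof -
    have "z * psiDE_deriv a b \<zeta> = of_real (pi / (b - a)) * cosh \<zeta> * (z * Qs a b \<zeta>)"
      using psiDE_deriv_eq_Qs[OF ab cosh_DE_nonzero[OF d \<zeta>]] by simp
    then have "cmod (z * psiDE_deriv a b \<zeta>) = pi / (b - a) * (cmod (cosh \<zeta>) * cmod (z * Qs a b \<zeta>))"
      using ab by (simp only: norm_mult norm_of_real) simp
    also have "\<dots> \<le> pi / (b - a) * (cosh (Re \<zeta>) * (\<bar>K\<bar> * (C / (cosh (Re \<zeta>))\<^sup>2)))"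
    proof (intro mult_left_mono mult_mono cmod_cosh_le)
      have "K * cmod (Qs a b \<zeta>) powr \<alpha> \<le> \<bar>K\<bar> * (C / (cosh (Re \<zeta>))\<^sup>2)"
        using C(2)[OF \<zeta>] by (intro mult_mono) auto
      then show "cmod (z * Qs a b \<zeta>) \<le> \<bar>K\<bar> * (C / (cosh (Re \<zeta>))\<^sup>2)" using z by linarith
    qed (use ab in auto)
    also have "\<dots> = (pi / (b - a) * (\<bar>K\<bar> * C)) / cosh (Re \<zeta>)"
      by (simp add: power2_eq_square)
    finally show ?thesis .
  qed
  then show ?thesis by blast
qed

lemma holomorphic_of_mult_Qs:
  assumes "a < b" "0 < d" "d < pi / 2" "(\<lambda>\<zeta>. f \<zeta> * Qs a b \<zeta>) holomorphic_on strip d"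
  shows "f holomorphic_on strip d"
proof -
  have "(\<lambda>\<zeta>. f \<zeta> * Qs a b \<zeta> / Qs a b \<zeta>) holomorphic_on strip d"
    by (rule holomorphic_on_divide[OF assms(4) Qs_holomorphic[OF assms(2,3)] Qs_nonzero[OF assms(1-3)]])
  then show ?thesis
    by (rule holomorphic_transform) (use Qs_nonzero[OF assms(1-3)] in simp)
qed

theorem theorem4p1:
  fixes a b \<alpha> d :: real and ua :: complex
    and g \<mu> :: "complex \<Rightarrow> complex" and k :: "complex \<Rightarrow> complex \<Rightarrow> complex"
    and u :: "real \<Rightarrow> complex"
  assumes "a < b" and "0 < \<alpha>" and "\<alpha> \<le> 1" and "0 < d" and "d < pi / 2"
    and "(\<lambda>\<zeta>. g \<zeta> * Qs a b \<zeta>) \<in> L_space a b d \<alpha>"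
    and "(\<lambda>\<zeta>. \<mu> \<zeta> * Qs a b \<zeta>) \<in> L_space a b d \<alpha>"
    and "\<forall>\<zeta>\<in>strip d. (\<lambda>\<omega>. k \<zeta> \<omega> * Qs a b \<omega>) \<in> L_space a b d \<alpha>"
    and "\<forall>\<omega>\<in>strip d. (\<lambda>\<zeta>. k \<zeta> \<omega> * Qs a b \<omega>) \<in> H_inf d"
    (* the constant in the L_alpha-bound of k(z,.)Q does not depend on z *)
    and "\<exists>K. \<forall>\<zeta>\<in>strip d. \<forall>\<omega>\<in>strip d.
           cmod (k \<zeta> \<omega> * Qs a b \<omega>) \<le> K * cmod (Qs a b \<omega>) powr \<alpha>"
    and "solves_ivp a b ua g \<mu> k u"
  shows "\<exists>U V. U holomorphic_on strip d
    \<and> (\<forall>t\<in>{a<..<b}. U (param a b t) = u t)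
    \<and> (\<forall>\<zeta>\<in>strip d. has_volterra a b k U \<zeta> (V \<zeta>))
    \<and> (\<lambda>\<zeta>. g \<zeta> * Qs a b \<zeta>) \<in> L_space a b d \<alpha>
    \<and> (\<lambda>\<zeta>. \<mu> \<zeta> * U \<zeta> * Qs a b \<zeta>) \<in> L_space a b d \<alpha>
    \<and> (\<lambda>\<zeta>. V \<zeta> * Qs a b \<zeta>) \<in> L_space a b d \<alpha>
    \<and> (\<forall>s\<in>{a<..<b}. (\<lambda>\<omega>. k (param a b s) \<omega> * U \<omega> * Qs a b \<omega>) \<in> L_space a b d \<alpha>)
    \<and> (\<forall>ka. (\<forall>\<omega>\<in>strip d. ((\<lambda>s. k (param a b s) \<omega>) \<longlongrightarrow> ka \<omega>) (at_right a)) \<longrightarrow>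
          (\<lambda>\<omega>. ka \<omega> * U \<omega> * Qs a b \<omega>) \<in> L_space a b d \<alpha>)
    \<and> (\<forall>kb. (\<forall>\<omega>\<in>strip d. ((\<lambda>s. k (param a b s) \<omega>) \<longlongrightarrow> kb \<omega>) (at_left b)) \<longrightarrow>
          (\<lambda>\<omega>. kb \<omega> * U \<omega> * Qs a b \<omega>) \<in> L_space a b d \<alpha>)"
proof -
  note ab = assms(1) and \<alpha> = assms(2,3) and d = assms(4,5)
    and gQ = assms(6) and \<mu>Q = assms(7) and kQ = assms(8) and kH = assms(9) and ivp = assms(11)
  obtain K where K: "\<And>\<zeta> \<omega>. \<zeta> \<in> strip d \<Longrightarrow> \<omega> \<in> strip d \<Longrightarrow>
      cmod (k \<zeta> \<omega> * Qs a b \<omega>) \<le> K * cmod (Qs a b \<omega>) powr \<alpha>"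
    using assms(10) by blast
  have decay: "\<exists>D. \<forall>\<zeta>\<in>strip d. cmod (f \<zeta> * psiDE_deriv a b \<zeta>) \<le> D / cosh (Re \<zeta>)"
    if "(\<lambda>\<zeta>. f \<zeta> * Qs a b \<zeta>) \<in> L_space a b d \<alpha>" for f
    using that psiDE_deriv_decay[OF ab d \<alpha>(1)] unfolding L_space_def by blast
  obtain D1 where D1: "\<And>\<zeta>. \<zeta> \<in> strip d \<Longrightarrow> cmod (g \<zeta> * psiDE_deriv a b \<zeta>) \<le> D1 / cosh (Re \<zeta>)"
    using decay[OF gQ] by blast
  obtain D2 where D2: "\<And>\<zeta>. \<zeta> \<in> strip d \<Longrightarrow> cmod (\<mu> \<zeta> * psiDE_deriv a b \<zeta>) \<le> D2 / cosh (Re \<zeta>)"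
    using decay[OF \<mu>Q] by blast
  obtain D3 where D3: "\<And>\<zeta>. \<zeta> \<in> strip d \<Longrightarrow> cmod (psiDE_deriv a b \<zeta>) \<le> D3 / cosh (Re \<zeta>)"
    using decay[of "\<lambda>_. 1"] Qs_in_L_space[OF ab d \<alpha>(2)] by auto
  obtain D4 where D4: "\<And>\<zeta> \<omega>. \<zeta> \<in> strip d \<Longrightarrow> \<omega> \<in> strip d \<Longrightarrow> cmod (k \<zeta> \<omega> * psiDE_deriv a b \<omega>) \<le> D4 / cosh (Re \<omega>)"
    using psiDE_deriv_decay[OF ab d \<alpha>(1), of K] K by meson
  define C where "C = \<bar>D1\<bar> + \<bar>D2\<bar> + \<bar>D3\<bar> + \<bar>D4\<bar> + 1"
  have C: "0 < C" by (simp add: C_def)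
  have up: "v \<le> C / cosh x" if "v \<le> D / cosh x" "D \<le> C" for v D x :: real
    using that(1) divide_right_mono[OF that(2), of "cosh x"] by simp
  have le_C: "D1 \<le> C" "D2 \<le> C" "D3 \<le> C" "D4 \<le> C" by (simp_all add: C_def)
  note bounds = up[OF D1 le_C(1)] up[OF D2 le_C(2)] up[OF D3 le_C(3)] up[OF D4 le_C(4)]
  have g_hol: "g holomorphic_on strip d" and \<mu>_hol: "\<mu> holomorphic_on strip d"
    using gQ \<mu>Q holomorphic_of_mult_Qs[OF ab d] unfolding L_space_def by blast+
  have k_hol: "k \<zeta> holomorphic_on strip d" if "\<zeta> \<in> strip d" for \<zeta>
    using kQ that holomorphic_of_mult_Qs[OF ab d] unfolding L_space_def by blast
  have k_hol1: "(\<lambda>\<zeta>. k \<zeta> \<omega>) holomorphic_on strip d" if "\<omega> \<in> strip d" for \<omega>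
  proof -
    have "(\<lambda>\<zeta>. k \<zeta> \<omega> * Qs a b \<omega>) holomorphic_on strip d"
      using kH that unfolding H_inf_def by blast
    from holomorphic_on_divide[OF this holomorphic_on_const Qs_nonzero[OF ab d that]]
    show ?thesis
      using Qs_nonzero[OF ab d that] by simp
  qed
  have psiDE_deriv_hol: "psiDE_deriv a b holomorphic_on strip d"
  proof (rule holomorphic_transform)
    show "(\<lambda>\<zeta>. of_real (pi / (b - a)) * cosh \<zeta> * Qs a b \<zeta>) holomorphic_on strip d"
      unfolding cosh_field_def by (intro holomorphic_intros Qs_holomorphic d) auto
  qed (use psiDE_deriv_eq_Qs[OF ab cosh_DE_nonzero[OF d]] in simp)
  obtain U V P where U: "U holomorphic_on strip d" "bounded (U ` strip d)"
    and V: "V holomorphic_on strip d" "bounded (V ` strip d)"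
    and P: "\<And>\<zeta>. \<zeta> \<in> strip d \<Longrightarrow> left_primitive d (\<lambda>\<omega>. k \<zeta> \<omega> * psiDE_deriv a b \<omega> * U \<omega>) (P \<zeta>)"
    and VP: "\<And>\<zeta>. \<zeta> \<in> strip d \<Longrightarrow> V \<zeta> = P \<zeta> \<zeta>"
    and pU: "left_primitive d (\<lambda>\<zeta>. g \<zeta> * psiDE_deriv a b \<zeta> + \<mu> \<zeta> * psiDE_deriv a b \<zeta> * U \<zeta> + V \<zeta> * psiDE_deriv a b \<zeta>) (\<lambda>\<zeta>. U \<zeta> - ua)"
    using volterra_equation_strip[OF d(1) C psiDE_deriv_hol, where G = "\<lambda>\<zeta>. g \<zeta> * psiDE_deriv a b \<zeta>"
        and m = "\<lambda>\<zeta>. \<mu> \<zeta> * psiDE_deriv a b \<zeta>" and \<kappa> = "\<lambda>\<zeta> \<omega>. k \<zeta> \<omega> * psiDE_deriv a b \<omega>" and ua = ua]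
      bounds g_hol \<mu>_hol k_hol k_hol1 psiDE_deriv_hol
    by (force intro!: holomorphic_intros)
  have P': "left_primitive d (\<lambda>\<omega>. k \<zeta> \<omega> * U \<omega> * psiDE_deriv a b \<omega>) (P \<zeta>)" if "\<zeta> \<in> strip d" for \<zeta>
    using P[OF that] by (simp add: mult_ac)
  have pU': "left_primitive d (\<lambda>\<zeta>. (g \<zeta> + \<mu> \<zeta> * U \<zeta> + V \<zeta>) * psiDE_deriv a b \<zeta>) (\<lambda>\<zeta>. U \<zeta> - ua)"
    using pU by (simp add: algebra_simps)
  have 1: "U (param a b t) = u t" if "t \<in> {a<..<b}" for t
    by (rule solves_ivp_unique[OF ab d(1) C U P' VP pU' k_hol bounds(3,2,4) ivp that])
  have 2: "has_volterra a b k U \<zeta> (V \<zeta>)" if \<zeta>: "\<zeta> \<in> strip d" for \<zeta>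
  proof -
    have "contour_integral (linepath (of_real x) \<zeta>) (\<lambda>\<omega>. k \<zeta> \<omega> * U \<omega> * deriv (psiDE a b) \<omega>)
        = P \<zeta> \<zeta> - P \<zeta> (of_real x)" for x
    proof -
      have "contour_integral (linepath (of_real x) \<zeta>) (\<lambda>\<omega>. k \<zeta> \<omega> * U \<omega> * deriv (psiDE a b) \<omega>)
        = contour_integral (linepath (of_real x) \<zeta>) (\<lambda>\<omega>. k \<zeta> \<omega> * U \<omega> * psiDE_deriv a b \<omega>)"
      proof (rule contour_integral_eq)
        fix \<omega> assume "\<omega> \<in> path_image (linepath (of_real x) \<zeta>)"
        then have "\<omega> \<in> strip d"
          using closed_segment_subset[OF of_real_in_strip[OF d(1)] \<zeta> convex_strip] by auto
        then show "k \<zeta> \<omega> * U \<omega> * deriv (psiDE a b) \<omega> = k \<zeta> \<omega> * U \<omega> * psiDE_deriv a b \<omega>"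
          using DERIV_imp_deriv[OF psiDE_has_field_derivative[OF cosh_DE_nonzero[OF d]]] by simp
      qed
      then show ?thesis
        using contour_integral_unique[OF left_primitive_contour_integral[OF P'[OF \<zeta>] of_real_in_strip[OF d(1)] \<zeta>]]
        by simp
    qed
    moreover have "((\<lambda>x. P \<zeta> \<zeta> - P \<zeta> (of_real x)) \<longlongrightarrow> P \<zeta> \<zeta> - 0) at_bot"
      using P'[OF \<zeta>] unfolding left_primitive_def by (intro tendsto_intros) blast
    ultimately show ?thesis
      unfolding has_volterra_def VP[OF \<zeta>] by simp
  qed
  have mult_U: "(\<lambda>\<zeta>. f \<zeta> * U \<zeta> * Qs a b \<zeta>) \<in> L_space a b d \<alpha>"
    if "(\<lambda>\<zeta>. f \<zeta> * Qs a b \<zeta>) \<in> L_space a b d \<alpha>" for f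
    using L_space_mult_bounded[OF that U] by (simp add: mult_ac)
  \<comment> \<open>Limits \<open>s \<rightarrow> a\<close> and \<open>s \<rightarrow> b\<close> are taken along sequences; the bound with \<open>K\<close> is the dominating one.\<close>
  have limit: "(\<lambda>\<omega>. ka \<omega> * U \<omega> * Qs a b \<omega>) \<in> L_space a b d \<alpha>"
    if X: "X \<longlonglongrightarrow> c" "\<And>n. X n \<in> S - {c}"
      and ka: "\<And>\<omega>. \<omega> \<in> strip d \<Longrightarrow> ((\<lambda>s. k (param a b s) \<omega>) \<longlongrightarrow> ka \<omega>) (at c within S)"
    for ka X c and S :: "real set"
  proof (intro mult_U L_space_pointwise_limit[OF ab d \<alpha>(1), where f = "\<lambda>n \<omega>. k (param a b (X n)) \<omega> * Qs a b \<omega>"])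
    have inS: "param a b s \<in> strip d" for s
      using d by (simp add: param_def)
    show "(\<lambda>\<omega>. k (param a b (X n)) \<omega> * Qs a b \<omega>) holomorphic_on strip d" for n
      using kQ inS unfolding L_space_def by blast
    show "cmod (k (param a b (X n)) \<omega> * Qs a b \<omega>) \<le> K * cmod (Qs a b \<omega>) powr \<alpha>" if "\<omega> \<in> strip d" for n \<omega>
      by (rule K[OF inS that])
    show "(\<lambda>n. k (param a b (X n)) \<omega> * Qs a b \<omega>) \<longlonglongrightarrow> ka \<omega> * Qs a b \<omega>" if "\<omega> \<in> strip d" for \<omega>
      using ka[OF that] X unfolding tendsto_at_iff_sequentially
      by (intro tendsto_intros) (auto simp: o_def)
  qed
  have 3: "(\<lambda>\<omega>. ka \<omega> * U \<omega> * Qs a b \<omega>) \<in> L_space a b d \<alpha>"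
    if "\<forall>\<omega>\<in>strip d. ((\<lambda>s. k (param a b s) \<omega>) \<longlongrightarrow> ka \<omega>) (at_right a)" for ka
    by (rule limit[where c = a and S = "{a<..}", OF LIMSEQ_inverse_real_of_nat_add]) (use that in auto)
  have 4: "(\<lambda>\<omega>. kb \<omega> * U \<omega> * Qs a b \<omega>) \<in> L_space a b d \<alpha>"
    if "\<forall>\<omega>\<in>strip d. ((\<lambda>s. k (param a b s) \<omega>) \<longlongrightarrow> kb \<omega>) (at_left b)" for kb
    by (rule limit[where c = b and S = "{..<b}", OF LIMSEQ_inverse_real_of_nat_add_minus]) (use that in auto)
  have "(\<lambda>\<zeta>. V \<zeta> * Qs a b \<zeta>) \<in> L_space a b d \<alpha>"
    by (rule L_space_mult_bounded[OF Qs_in_L_space[OF ab d \<alpha>(2)] V])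
  moreover have "param a b s \<in> strip d" for s
    using d by (simp add: param_def)
  ultimately show ?thesis
    using U(1) 1 2 3 4 gQ mult_U[OF \<mu>Q] mult_U kQ
    by (intro exI[of _ U] exI[of _ V]) simp
qed

end
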